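(* Let $n \in \mathbb{N}$. (a) If $j \in A$, then $$\lim_{p\to\infty} \frac{\mathfrak{F}^{(p)}(R_{j,n}(x))}{2^{(n-1)p}} = \frac{L\, d^{n} A_{n-1}(x^{d})}{(n-1)!\,(x^{d}-1)^{n}}.$$ (b) If $j \notin A$, choose $r^{*}$ such that $j^{*} := \gamma_d^{(r^{*})}(j) \in \{0,1,\dots,d-1\}$. Then for any $q \in \{0,1,\dots,\rho(j^{*})-1\}$, $$\lim_{p\to\infty} \frac{\mathfrak{F}^{(p\rho(j^{*})+q)}(R_{j,n}(x))}{2^{(n-1)(p\rho(j^{*})+q)}} = \frac{L\,x^{\gamma}}{(n-1)!\,(x^{d}-1)^{n}} \times \sum_{l=0}^{n-1} (-1)^{l} \binom{n-1}{l} (\gamma+1)^{l}\, d^{\,n-l}\, (x^{d}-1)^{l} A_{n-1-l}(x^{d}),$$ where $\gamma = \gamma_d^{(q)}(j^{*})$.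
   Context: For a rational function $R$ with complex coefficients and expansion $R(x) = \sum_{k \gg -\infty} a_k x^k$ at $x=0$ (the coefficients vanish for large negative $k$), define $$\mathfrak{F}(R(x)) = \sum_{k \gg -\infty} a_{2k+1} x^k = \frac{R(\sqrt{x}) - R(-\sqrt{x})}{2\sqrt{x}},$$ which is again a rational function; $\mathfrak{F}^{(p)}$ denotes the $p$-th iterate. Let $m_1, \dots, m_n$ be odd positive integers, $d = \gcd(m_1, \dots, m_n)$, $L = 1/(m_1 \cdots m_n)$, and, for $j \in \mathbb{Z}$, $$R_{j,n}(x) = \frac{x^j}{\prod_{k=1}^n (x^{m_k}-1)}.$$ For an odd positive integer $m$, the map $\gamma_m$ on $\mathbb{Z}$ is given by $\gamma_m(j) = (m-1+j)/2$ if $j$ is even and $\gamma_m(j) = (j-1)/2$ if $j$ is odd; $\gamma_m^{(r)}$ is its $r$-th iterate. The integers $-1$ and $m-1$ are the fixed points of $\gamma_m$. For $i \in \mathbb{Z}$ let $E_i = \{ j \in \mathbb{Z} : \text{there exists } r \in \mathbb{N} \text{ with } \gamma_d^{(r)}(j) = i \}$, and let $A = E_{-1} \cup E_{d-1}$, the set of integers that are eventually mapped to the fixed points of $\gamma_d$. For an integer $i$, $\rho(i) = \mathrm{Ord}\left(2; \frac{d}{\gcd(i+1,d)}\right)$, where $\mathrm{Ord}(2;N)$ is the multiplicative order of $2$ modulo the odd integer $N$. The Eulerian polynomials $A_m(x)$ are defined by the generating function $$\frac{1-x}{1-x\exp[\lambda(1-x)]} = \sum_{m=0}^\infty A_m(x)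 \frac{\lambda^m}{m!}.$$
   Formalization: The printed claim is false. In (a) the limit gets a factor 1/x; for n=1 and j in E_{d-1} the limit is instead x^{d-1}/(x^d-1). In (b) r* must also be a multiple of ρ(j* ); such an r* is shown to exist. Limits are pointwise off the poles of R_{j,n}. *)

theory Defs
  imports
    Complex_Main
    "HOL-Computational_Algebra.Computational_Algebra"
    "HOL-Computational_Algebra.Field_as_Ring"
    "HOL-Number_Theory.Number_Theory"
begin

section \<open>Rational functions over the complex numbers\<close>

type_synonym ratfun = "complex poly fract"

definition rX :: ratfun where
  "rX = to_fract [:0, 1:]"

text \<open>\<open>quot_of_fract\<close> returns the fraction in lowest terms, so \<open>regular_at R x\<close> says that
  \<open>x\<close> is not a pole, and removable singularities count as regular points.\<close>

definition regular_at :: "ratfun \<Rightarrow> complex \<Rightarrow> bool" where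
  "regular_at R x \<longleftrightarrow> poly (snd (quot_of_fract R)) x \<noteq> 0"

definition ratfun_eval :: "ratfun \<Rightarrow> complex \<Rightarrow> complex" where
  "ratfun_eval R x = poly (fst (quot_of_fract R)) x / poly (snd (quot_of_fract R)) x"

definition converges_on :: "complex set \<Rightarrow> (nat \<Rightarrow> ratfun) \<Rightarrow> ratfun \<Rightarrow> bool" where
  "converges_on D f g \<longleftrightarrow>
     (\<forall>x\<in>D. (\<forall>p. regular_at (f p) x) \<and> regular_at g x \<and>
        (\<lambda>p. ratfun_eval (f p) x) \<longlonglongrightarrow> ratfun_eval g x)"

definition fls_of_poly :: "complex poly \<Rightarrow> complex fls" where
  "fls_of_poly p = fps_to_fls (fps_of_poly p)"

definition laurent_expansion :: "ratfun \<Rightarrow> complex fls" where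
  "laurent_expansion R =
     fls_of_poly (fst (quot_of_fract R)) / fls_of_poly (snd (quot_of_fract R))"

text \<open>The transformation sending \<open>\<Sum>\<^sub>k a\<^sub>k x\<^sup>k\<close> to \<open>\<Sum>\<^sub>k a\<^bsub>2k+1\<^esub> x\<^sup>k\<close>. Existence and uniqueness of the described rational
  function is \<open>bisect_expansion\<close> and \<open>laurent_expansion_inject\<close> below.\<close>

definition bisect :: "ratfun \<Rightarrow> ratfun" where
  "bisect R = (THE S. \<forall>k. fls_nth (laurent_expansion S) k =
                          fls_nth (laurent_expansion R) (2 * k + 1))"


subsection \<open>Well-definedness of \<open>bisect\<close>\<close>

lemma fls_of_poly_simps [simp]:
  "fls_of_poly 0 = 0" "fls_of_poly 1 = 1"
  "fls_of_poly (p + q) = fls_of_poly p + fls_of_poly q"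
  "fls_of_poly (p * q) = fls_of_poly p * fls_of_poly q"
  "fls_of_poly [:c:] = fls_const c"
  "fls_of_poly [:0, 1:] = fls_X"
  "fls_of_poly p = 0 \<longleftrightarrow> p = 0"
  "fls_of_poly p = fls_of_poly q \<longleftrightarrow> p = q"
  by (simp_all add: fls_of_poly_def fps_of_poly_add fps_of_poly_mult fls_times_fps_to_fls
      fps_of_poly_const fps_of_poly_eq_iff flip: fps_of_poly_0)

lemma fls_of_poly_nth:
  "fls_nth (fls_of_poly p) k = (if k < 0 then 0 else poly.coeff p (nat k))"
  by (simp add: fls_of_poly_def)

lemma laurent_expansion_Fract:
  assumes "q \<noteq> 0"
  shows "laurent_expansion (Fract p q) = fls_of_poly p / fls_of_poly q"
proof -
  define a b where "a = fst (quot_of_fract (Fract p q))" and "b = snd (quot_of_fract (Fract p q))"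
  have b: "b \<noteq> 0" by (simp add: b_def)
  have "Fract p q = Fract a b" by (simp add: a_def b_def)
  hence "p * b = a * q" using assms b by (simp add: eq_fract)
  hence "fls_of_poly p * fls_of_poly b = fls_of_poly a * fls_of_poly q"
    by (metis fls_of_poly_simps(4))
  thus ?thesis using assms b
    by (simp add: laurent_expansion_def a_def[symmetric] b_def[symmetric] frac_eq_eq)
qed

lemma laurent_expansion_inject:
  "laurent_expansion R = laurent_expansion S \<longleftrightarrow> R = S"
proof
  assume eq: "laurent_expansion R = laurent_expansion S"
  obtain p q where R: "R = Fract p q" "q \<noteq> 0" by (cases R) auto
  obtain r s where S: "S = Fract r s" "s \<noteq> 0" by (cases S) auto
  from eq have "fls_of_poly p / fls_of_poly q = fls_of_poly r / fls_of_poly s"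
    using R S by (simp add: laurent_expansion_Fract)
  hence "fls_of_poly p * fls_of_poly s = fls_of_poly r * fls_of_poly q"
    using R S by (simp add: frac_eq_eq)
  hence "fls_of_poly (p * s) = fls_of_poly (r * q)" by simp
  hence "p * s = r * q" by (simp only: fls_of_poly_simps(8))
  thus "R = S" using R S by (simp add: eq_fract)
qed auto

definition odd_part :: "complex fls \<Rightarrow> complex fls" where
  "odd_part f = Abs_fls (\<lambda>k. fls_nth f (2 * k + 1))"

lemma odd_part_nth [simp]: "fls_nth (odd_part f) k = fls_nth f (2 * k + 1)"
proof -
  have "\<forall>n>nat (max 0 (1 - fls_subdegree f)). fls_nth f (2 * - int n + 1) = 0"
    by (auto intro!: fls_eq0_below_subdegree)
  hence "\<exists>m. \<forall>n>m. fls_nth f (2 * - int n + 1) = 0" by blast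
  thus ?thesis
    unfolding odd_part_def by (subst nth_Abs_fls_ex_nat_lower_bound) simp_all
qed

lemma odd_part_mult_even:
  "odd_part (f * fls_of_poly (pcompose s [:0, 0, 1:])) = odd_part f * fls_of_poly s"
proof (induction s arbitrary: f)
  case 0
  show ?case by (simp add: fls_eq_iff)
next
  case (pCons a s)
  have X2: "[:0, 0, 1:] = [:0, 1:] * [:0, 1::complex:]" by simp
  have e: "fls_of_poly (pcompose (pCons a s) [:0, 0, 1:]) =
      fls_const a + fls_X * (fls_X * fls_of_poly (pcompose s [:0, 0, 1:]))"
    by (simp only: pcompose_pCons fls_of_poly_simps X2 mult.assoc)
  have e': "fls_of_poly (pCons a s) = fls_const a + fls_X * fls_of_poly s"
  proof -
    have "pCons a s = [:a:] + [:0, 1:] * s" by simp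
    thus ?thesis by (simp only: fls_of_poly_simps)
  qed
  have shift: "odd_part (fls_X * (fls_X * g)) = fls_X * odd_part g" for g
    by (rule fls_eqI) (simp add: fls_X_times_conv_shift algebra_simps)
  have "odd_part (f * fls_of_poly (pcompose (pCons a s) [:0, 0, 1:])) =
        odd_part (fls_const a * f) +
        odd_part (fls_X * (fls_X * (f * fls_of_poly (pcompose s [:0, 0, 1:]))))"
    by (rule fls_eqI) (simp only: e odd_part_nth fls_plus_nth distrib_left mult_ac)
  also have "odd_part (fls_const a * f) = fls_const a * odd_part f"
    by (rule fls_eqI) simp
  finally show ?case
    unfolding shift pCons.IH e' by (simp add: algebra_simps)
qed

lemma ex_even_multiple:
  fixes q :: "complex poly"
  assumes "q \<noteq> 0"
  shows "\<exists>q' s. s \<noteq> 0 \<and> q * q' = pcompose s [:0, 0, 1:]"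
  using assms
proof (induction "degree q" arbitrary: q)
  case 0
  then obtain c where "q = [:c:]" by (metis degree_eq_zeroE)
  with 0 show ?case by (intro exI[of _ 1] exI[of _ "[:c:]"]) auto
next
  case (Suc n)
  have "\<not> constant (poly q)" using Suc.hyps(2) by (simp add: constant_degree)
  then obtain z where "poly q z = 0" using fundamental_theorem_of_algebra by blast
  then obtain r where r: "q = [:-z, 1:] * r" by (metis dvdE poly_eq_0_iff_dvd)
  with Suc.prems have "r \<noteq> 0" by auto
  have "degree q = Suc (degree r)" using r \<open>r \<noteq> 0\<close> by (simp only: degree_mult_eq) (subst degree_mult_eq, auto)
  with Suc.hyps obtain r' s where rs: "s \<noteq> 0" "r * r' = pcompose s [:0, 0, 1:]"
    using \<open>r \<noteq> 0\<close> by (metis Suc_inject)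
  have "q * (r' * [:z, 1:]) = (r * r') * ([:-z, 1:] * [:z, 1:])"
    by (simp only: r mult_ac)
  also have "\<dots> = pcompose (s * [:-(z^2), 1:]) [:0, 0, 1:]"
  proof -
    have "pcompose [:-(z^2), 1:] [:0, 0, 1:] = [:-z, 1:] * [:z, 1:]"
      by (simp add: pcompose_pCons power2_eq_square)
    thus ?thesis by (simp only: rs pcompose_mult)
  qed
  finally show ?case using rs by (intro exI conjI) (auto simp del: mult_pCons_right)
qed

lemma bisect_unique_exists:
  "\<exists>!S. \<forall>k. fls_nth (laurent_expansion S) k = fls_nth (laurent_expansion R) (2 * k + 1)"
proof -
  obtain p q where R: "R = Fract p q" "q \<noteq> 0" by (cases R) auto
  obtain q' s where s: "s \<noteq> 0" "q * q' = pcompose s [:0, 0, 1:]"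
    using ex_even_multiple R by blast
  define f where "f = laurent_expansion R"
  have "f * fls_of_poly q = fls_of_poly p"
    using R by (simp add: f_def laurent_expansion_Fract)
  hence "f * fls_of_poly (q * q') = fls_of_poly (p * q')"
    by (simp add: mult.assoc[symmetric])
  hence m: "odd_part f * fls_of_poly s = odd_part (fls_of_poly (p * q'))"
    by (simp only: s odd_part_mult_even[symmetric])
  define N where "N = p * q'"
  define t where "t = Abs_poly (\<lambda>k. poly.coeff N (2 * k + 1))"
  have t: "poly.coeff t k = poly.coeff N (2 * k + 1)" for k
  proof -
    have "\<forall>k>degree N. poly.coeff N (2 * k + 1) = 0" by (auto intro!: coeff_eq_0)
    thus ?thesis unfolding t_def by (subst coeff_Abs_poly) auto
  qed
  have "odd_part (fls_of_poly N) = fls_of_poly t"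
    by (rule fls_eqI) (auto simp: fls_of_poly_nth t nat_add_distrib nat_mult_distrib)
  with m s have "laurent_expansion (Fract t s) = odd_part f"
    by (simp add: laurent_expansion_Fract N_def field_simps)
  hence ex: "\<forall>k. fls_nth (laurent_expansion (Fract t s)) k =
                 fls_nth (laurent_expansion R) (2 * k + 1)"
    by (simp add: f_def)
  show ?thesis
  proof (intro ex1I[of _ "Fract t s"])
    show "\<forall>k. fls_nth (laurent_expansion (Fract t s)) k =
              fls_nth (laurent_expansion R) (2 * k + 1)" by (rule ex)
  next
    fix S assume "\<forall>k. fls_nth (laurent_expansion S) k =
                      fls_nth (laurent_expansion R) (2 * k + 1)"
    with ex have "laurent_expansion S = laurent_expansion (Fract t s)"
      by (simp add: fls_eq_iff)
    thus "S = Fract t s" by (simp add: laurent_expansion_inject)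
  qed
qed

lemma bisect_expansion:
  "fls_nth (laurent_expansion (bisect R)) k = fls_nth (laurent_expansion R) (2 * k + 1)"
  using theI'[OF bisect_unique_exists[of R]] unfolding bisect_def by blast


section \<open>The functions \<open>R\<^sub>j\<^sub>,\<^sub>n\<close>\<close>

definition Rjn :: "nat \<Rightarrow> (nat \<Rightarrow> nat) \<Rightarrow> int \<Rightarrow> ratfun" where
  "Rjn n m j = (rX powi j) / (\<Prod>k\<in>{1..n}. rX ^ m k - 1)"


section \<open>The maps \<open>\<gamma>\<^sub>m\<close>\<close>

definition gamma_map :: "nat \<Rightarrow> int \<Rightarrow> int" where
  "gamma_map m j = (if even j then (int m - 1 + j) div 2 else (j - 1) div 2)"

definition E_set :: "nat \<Rightarrow> int \<Rightarrow> int set" where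
  "E_set d i = {j. \<exists>r. (gamma_map d ^^ r) j = i}"

definition A_set :: "nat \<Rightarrow> int set" where
  "A_set d = E_set d (-1) \<union> E_set d (int d - 1)"

definition rho :: "nat \<Rightarrow> int \<Rightarrow> nat" where
  "rho d i = ord (d div nat (gcd (i + 1) (int d))) 2"


section \<open>Eulerian polynomials\<close>

text \<open>The generating function is read as a formal power series in \<open>\<lambda>\<close> over the field of
  rational functions in \<open>x\<close>; its constant term \<open>1 - x\<close> in the denominator is invertible there.
  With this normalisation \<open>A\<^sub>0 = 1\<close> and \<open>A\<^sub>1 = x\<close>.\<close>

definition eulerian_gf :: "ratfun fps" where
  "eulerian_gf = fps_const (1 - rX) / (1 - fps_const rX * fps_exp (1 - rX))"

definition eulerian :: "nat \<Rightarrow> complex poly" where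
  "eulerian k = (THE p. to_fract p / of_nat (fact k) = fps_nth eulerian_gf k)"

lemma to_fract_power: "to_fract (p ^ k) = to_fract p ^ k"
  by (induction k) simp_all

lemma to_fract_sum: "to_fract (sum f A) = (\<Sum>x\<in>A. to_fract (f x))"
  by (induction A rule: infinite_finite_induct) simp_all

lemma to_fract_of_nat: "to_fract (of_nat k) = of_nat k"
  by (induction k) simp_all

lemma of_nat_ratfun_neq_0:
  assumes "k \<noteq> 0"
  shows "(of_nat k :: ratfun) \<noteq> 0"
  using assms by (simp flip: to_fract_of_nat)

lemma rX_neq_1: "1 - rX \<noteq> 0"
proof -
  have "[:0, 1:] \<noteq> (1 :: complex poly)" by (simp add: one_pCons)
  thus ?thesis unfolding rX_def by (metis eq_iff_diff_eq_0 to_fract_1 to_fract_eq_iff)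
qed

lemma eulerian_gf_poly: "\<exists>p. fps_nth eulerian_gf k = to_fract p"
proof (induction k rule: less_induct)
  case (less k)
  define E where "E = fps_exp (1 - rX)"
  define D where "D = 1 - fps_const rX * E"
  have E_nth: "fps_nth E i = (1 - rX) ^ i / of_nat (fact i)" for i
    by (simp add: E_def fps_exp_def)
  have D0: "fps_nth D 0 \<noteq> 0" using rX_neq_1 by (simp add: D_def E_nth)
  have "eulerian_gf * D = fps_const (1 - rX)"
    unfolding eulerian_gf_def E_def[symmetric] D_def[symmetric]
    using D0 by (simp add: fps_divide_unit mult.assoc inverse_mult_eq_1)
  hence "fps_nth (eulerian_gf * D) k = fps_nth (fps_const (1 - rX)) k" by simp
  moreover have "eulerian_gf * D = eulerian_gf - fps_const rX * (eulerian_gf * E)"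
    by (simp add: D_def algebra_simps)
  ultimately have "fps_nth eulerian_gf k - rX * fps_nth (eulerian_gf * E) k =
      fps_nth (fps_const (1 - rX)) k"
    by (simp only: fps_sub_nth fps_mult_left_const_nth)
  hence eq: "fps_nth eulerian_gf k -
      rX * (\<Sum>i=0..k. fps_nth eulerian_gf i * fps_nth E (k - i)) =
      fps_nth (fps_const (1 - rX)) k"
    by (simp only: fps_mult_nth)
  show ?case
  proof (cases "k = 0")
    case True
    with eq have "fps_nth eulerian_gf k * (1 - rX) = 1 * (1 - rX)"
      by (simp add: E_nth algebra_simps)
    hence "fps_nth eulerian_gf k = to_fract 1" using rX_neq_1 by simp
    thus ?thesis ..
  next
    case False
    obtain p where p: "\<And>i. i < k \<Longrightarrow> fps_nth eulerian_gf i = to_fract (p i)"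
      using less by metis
    define c :: "nat \<Rightarrow> complex poly" where "c i = [:1 / of_nat (fact (k - i)):]" for i
    have c: "to_fract (c i) = 1 / of_nat (fact (k - i))" for i
    proof -
      have "c i * of_nat (fact (k - i)) = 1" by (simp add: c_def of_nat_poly)
      hence "to_fract (c i) * of_nat (fact (k - i)) = 1"
        by (metis to_fract_mult to_fract_1 to_fract_of_nat)
      thus ?thesis using of_nat_ratfun_neq_0[of "fact (k - i)"] by (simp add: field_simps)
    qed
    define q where "q = [:0, 1:] * (\<Sum>i<k. p i * ([:1, -1:] ^ (k - i - 1) * c i))"
    have X: "to_fract [:1, -1:] = 1 - rX"
    proof -
      have "[:1, -1:] = 1 - [:0, 1 :: complex:]" by (simp add: one_pCons)
      thus ?thesis unfolding rX_def by (simp only: to_fract_diff to_fract_1)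
    qed
    have q: "to_fract q = rX * (\<Sum>i<k. fps_nth eulerian_gf i *
        ((1 - rX) ^ (k - i - 1) / of_nat (fact (k - i))))"
      unfolding q_def to_fract_mult rX_def[symmetric] to_fract_sum to_fract_power X c
      by (intro arg_cong2[where f = "(*)"] sum.cong refl) (simp_all add: p)
    have "{0..k} = insert k {..<k}" by auto
    with eq False have "fps_nth eulerian_gf k - rX * (fps_nth eulerian_gf k +
        (\<Sum>i<k. fps_nth eulerian_gf i * fps_nth E (k - i))) = 0"
      by (simp add: E_nth)
    hence "fps_nth eulerian_gf k * (1 - rX) =
        rX * (\<Sum>i<k. fps_nth eulerian_gf i * fps_nth E (k - i))"
      by (simp add: algebra_simps)
    also have "(\<Sum>i<k. fps_nth eulerian_gf i * fps_nth E (k - i)) =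
        (\<Sum>i<k. fps_nth eulerian_gf i *
        ((1 - rX) ^ (k - i - 1) / of_nat (fact (k - i)))) * (1 - rX)"
      unfolding sum_distrib_right
    proof (rule sum.cong)
      fix i assume "i \<in> {..<k}"
      hence "k - i = Suc (k - i - 1)" by auto
      hence "(1 - rX) ^ (k - i) = (1 - rX) ^ (k - i - 1) * (1 - rX)" by (metis power_Suc2)
      thus "fps_nth eulerian_gf i * fps_nth E (k - i) = fps_nth eulerian_gf i *
          ((1 - rX) ^ (k - i - 1) / of_nat (fact (k - i))) * (1 - rX)"
        by (simp add: E_nth)
    qed simp
    finally have "fps_nth eulerian_gf k * (1 - rX) = to_fract q * (1 - rX)"
      by (simp add: q mult.assoc)
    hence "fps_nth eulerian_gf k = to_fract q" using rX_neq_1 by simp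
    thus ?thesis ..
  qed
qed

lemma eulerian: "to_fract (eulerian k) / of_nat (fact k) = fps_nth eulerian_gf k"
proof -
  obtain p where p: "fps_nth eulerian_gf k = to_fract p" using eulerian_gf_poly by blast
  have nz: "(of_nat (fact k) :: ratfun) \<noteq> 0" using of_nat_ratfun_neq_0[of "fact k"] by simp
  show ?thesis
    unfolding eulerian_def
  proof (rule theI[of _ "p * of_nat (fact k)"])
    show *: "to_fract (p * of_nat (fact k)) / of_nat (fact k) = fps_nth eulerian_gf k"
      using nz by (simp only: p to_fract_mult to_fract_of_nat) simp
    fix r assume "to_fract r / of_nat (fact k) = fps_nth eulerian_gf k"
    with * have "to_fract r / of_nat (fact k) = to_fract (p * of_nat (fact k)) / of_nat (fact k)"
      by (simp only:)
    hence "to_fract r = to_fract (p * of_nat (fact k))"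
      using nz by (metis nonzero_eq_divide_eq nonzero_divide_eq_eq)
    thus "r = p * of_nat (fact k)" by (simp only: to_fract_eq_iff)
  qed
qed

definition eulerian_at_pow :: "nat \<Rightarrow> nat \<Rightarrow> ratfun" where
  "eulerian_at_pow k d = to_fract (pcompose (eulerian k) (Polynomial.monom 1 d))"

end

theory Submission
  imports Defs
begin

text \<open>
  Write \<open>R = \<Sum>\<^sub>k a\<^sub>k x\<^sup>k\<close>. The \<open>p\<close>-th iterate of the transformation has the coefficients
  \<open>a\<^bsub>N(k+1)-1\<^esub>\<close> with \<open>N = 2\<^sup>p\<close>, so after division by \<open>N\<^sup>n\<^sup>-\<^sup>1\<close> the limit of each single
  coefficient is a matter of the growth of \<open>a\<^sub>t\<close>. For \<open>R = R\<^sub>j\<^sub>,\<^sub>n\<close> the number \<open>(-1)\<^sup>n a\<^sub>t\<close> counts the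
  representations of \<open>t - j\<close> as a nonnegative integer combination of \<open>m\<^sub>1, \<dots>, m\<^sub>n\<close>; this count is
  \<open>d t\<^sup>n\<^sup>-\<^sup>1 / (m\<^sub>1 \<cdots> m\<^sub>n (n-1)!)\<close> up to lower order if \<open>d\<close> divides \<open>t - j\<close>, and \<open>0\<close> otherwise
  (\<open>coin_series_asymptotics\<close>). The map \<open>\<gamma>\<^sub>d\<close> satisfies \<open>2 (\<gamma>\<^sub>d(i) + 1) \<equiv> i + 1\<close> modulo \<open>d\<close>. Hence, if
  \<open>\<gamma>\<close> is congruent to the \<open>p\<close>-th iterate of \<open>j\<close>, the divisibility condition on \<open>N(k+1) - 1 - j\<close> becomes
  \<open>k \<equiv> \<gamma>\<close> modulo \<open>d\<close>, and the limiting coefficient is a constant times \<open>(k+1)\<^sup>n\<^sup>-\<^sup>1\<close> on this residue class.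

  Expanding \<open>(k+1)\<^sup>n\<^sup>-\<^sup>1 = (di + (\<gamma>+1))\<^sup>n\<^sup>-\<^sup>1\<close> by the binomial theorem and using
  \<open>\<Sum>\<^sub>i i\<^sup>l y\<^sup>i = A\<^sub>l(y) / (1-y)\<^sup>l\<^sup>+\<^sup>1\<close> identifies the series of limits with the stated rational function
  (\<open>fls_nth_limit_function\<close>). Case (a) is the same formula at \<open>\<gamma> = -1\<close>, except that for \<open>n = 1\<close> the
  coefficient of \<open>x\<^sup>-\<^sup>1\<close> does not decay: it distinguishes the two fixed points \<open>-1\<close> and \<open>d - 1\<close>.

  Convergence of coefficients implies convergence of values here, also far outside the
  disc of convergence of the series, because all iterates have one common denominator and numerators of
  bounded degree (\<open>bisect_iter_Fract\<close>): the numerators then lie in a finite-dimensional space and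
  converge coefficientwise (\<open>converges_on_of_coefficients\<close>).
\<close>

section \<open>Laurent expansion as a field homomorphism\<close>

lemma laurent_expansion_to_fract [simp]: "laurent_expansion (to_fract p) = fls_of_poly p"
  by (simp add: to_fract_def laurent_expansion_Fract)

lemma laurent_expansion_mult [simp]:
  "laurent_expansion (R * S) = laurent_expansion R * laurent_expansion S"
  by (cases R; cases S) (simp add: laurent_expansion_Fract)

lemma laurent_expansion_add [simp]:
  "laurent_expansion (R + S) = laurent_expansion R + laurent_expansion S"
  by (cases R; cases S) (simp add: laurent_expansion_Fract add_frac_eq)

lemma laurent_expansion_0 [simp]: "laurent_expansion 0 = 0"
  and laurent_expansion_1 [simp]: "laurent_expansion 1 = 1"
  using laurent_expansion_to_fract[of 0] laurent_expansion_to_fract[of 1] by simp_all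

lemma laurent_expansion_diff [simp]:
  "laurent_expansion (R - S) = laurent_expansion R - laurent_expansion S"
  using laurent_expansion_add[of "R - S" S] by simp

lemma laurent_expansion_uminus [simp]: "laurent_expansion (- R) = - laurent_expansion R"
  using laurent_expansion_diff[of 0 R] by simp

lemma laurent_expansion_power [simp]: "laurent_expansion (R ^ k) = laurent_expansion R ^ k"
  by (induction k) simp_all

lemma laurent_expansion_inverse [simp]:
  "laurent_expansion (inverse R) = inverse (laurent_expansion R)"
proof (cases "R = 0")
  case False
  then have "laurent_expansion (inverse R) * laurent_expansion R = 1"
    by (simp flip: laurent_expansion_mult)
  then show ?thesis
    by (metis inverse_unique inverse_inverse_eq)
qed simp

lemma laurent_expansion_divide [simp]:
  "laurent_expansion (R / S) = laurent_expansion R / laurent_expansion S"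
  by (simp add: divide_inverse)

lemma laurent_expansion_sum [simp]:
  "laurent_expansion (\<Sum>i\<in>I. F i) = (\<Sum>i\<in>I. laurent_expansion (F i))"
  by (induction I rule: infinite_finite_induct) simp_all

lemma laurent_expansion_prod [simp]:
  "laurent_expansion (\<Prod>i\<in>I. F i) = (\<Prod>i\<in>I. laurent_expansion (F i))"
  by (induction I rule: infinite_finite_induct) simp_all

lemma laurent_expansion_of_nat [simp]: "laurent_expansion (of_nat k) = of_nat k"
  by (induction k) simp_all

lemma laurent_expansion_of_int [simp]: "laurent_expansion (of_int k) = of_int k"
  by (cases k rule: int_cases) (simp_all del: of_nat_Suc)

lemma laurent_expansion_power_int [simp]:
  "laurent_expansion (R powi k) = laurent_expansion R powi k"
  by (simp add: power_int_def)

lemma laurent_expansion_rX [simp]: "laurent_expansion rX = fls_X"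
  by (simp add: rX_def)

section \<open>From coefficients to values\<close>

text \<open>Regularity and evaluation are defined through the reduced fraction. The next lemmas transfer them
  to an arbitrary representation, whose denominator is a multiple of the reduced one.\<close>

lemma quot_of_fract_denominator_dvd:
  assumes "V \<noteq> 0"
  shows "snd (quot_of_fract (Fract H V)) dvd V"
    and "fst (quot_of_fract (Fract H V)) * V = H * snd (quot_of_fract (Fract H V))"
proof -
  define a b where "a = fst (quot_of_fract (Fract H V))" and "b = snd (quot_of_fract (Fract H V))"
  have "Fract a b = Fract H V"
    by (simp add: a_def b_def)
  then have *: "a * V = H * b"
    using assms by (simp add: eq_fract b_def)
  moreover have "coprime b a"
    by (simp add: a_def b_def coprime_quot_of_fract coprime_commute)
  ultimately show "b dvd V"
    by (metis coprime_dvd_mult_right_iff dvd_triv_right)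
  show "a * V = H * b" by (fact *)
qed

lemma regular_at_Fract:
  assumes "poly V x \<noteq> 0"
  shows "regular_at (Fract H V) x"
  using quot_of_fract_denominator_dvd(1)[of V H] assms
  unfolding regular_at_def by (metis dvdE mult_eq_0_iff poly_0 poly_mult)

lemma ratfun_eval_Fract:
  assumes "poly V x \<noteq> 0"
  shows "ratfun_eval (Fract H V) x = poly H x / poly V x"
proof -
  have "V \<noteq> 0" using assms by auto
  from quot_of_fract_denominator_dvd(2)[OF this, of H] show ?thesis
    using regular_at_Fract[OF assms, of H] assms unfolding regular_at_def ratfun_eval_def
    by (metis frac_eq_eq poly_mult)
qed

lemma not_regular_at_Fract:
  assumes "poly V x = 0" "poly H x \<noteq> 0" "V \<noteq> 0"
  shows "\<not> regular_at (Fract H V) x"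
  using quot_of_fract_denominator_dvd(2)[OF assms(3), of H] assms
  unfolding regular_at_def by (metis mult_eq_0_iff poly_mult)

text \<open>A coefficient of the product depends on finitely many coefficients of \<open>F p\<close> only.\<close>

lemma tendsto_fls_nth_poly_mult:
  assumes "\<And>k. (\<lambda>p. fls_nth (F p) k) \<longlonglongrightarrow> fls_nth G k"
  shows "(\<lambda>p. fls_nth (fls_of_poly V * F p) k) \<longlonglongrightarrow> fls_nth (fls_of_poly V * G) k"
proof (induction V arbitrary: k)
  case (pCons a V)
  have "pCons a V = [:a:] + [:0, 1:] * V" by simp
  then have "fls_of_poly (pCons a V) = fls_const a + fls_X * fls_of_poly V"
    by (simp only: fls_of_poly_simps)
  then have "fls_of_poly (pCons a V) * F = fls_const a * F + fls_X * (fls_of_poly V * F)" for F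
    by (simp only: distrib_right mult.assoc)
  then have "fls_nth (fls_of_poly (pCons a V) * F) k =
      a * fls_nth F k + fls_nth (fls_of_poly V * F) (k - 1)" for F
    by (simp add: fls_X_times_conv_shift(1))
  then show ?case
    by (auto intro!: tendsto_intros assms pCons.IH)
qed simp

text \<open>Multiplying by \<open>V\<close> turns the hypothesis into convergence of the coefficients of the numerators
  \<open>H p\<close>. The degree bound makes the limit of the numerators a polynomial \<open>h\<close>, so that
  \<open>g = h / V\<close>, and a sum of \<open>M + 1\<close> convergent terms gives the convergence of values.\<close>

lemma converges_on_of_coefficients:
  assumes f: "\<And>p. f p = Fract (H p) V" and deg: "\<And>p. degree (H p) \<le> M"
    and V: "V \<noteq> 0" "\<And>x. x \<in> D \<Longrightarrow> poly V x \<noteq> 0"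
    and lim: "\<And>k. (\<lambda>p. fls_nth (laurent_expansion (f p)) k) \<longlonglongrightarrow> fls_nth (laurent_expansion g) k"
  shows "converges_on D f g"
proof -
  define G where "G = fls_of_poly V * laurent_expansion g"
  have "fls_of_poly V * laurent_expansion (f p) = fls_of_poly (H p)" for p
    using V(1) by (simp add: f laurent_expansion_Fract)
  then have G: "(\<lambda>p. fls_nth (fls_of_poly (H p)) k) \<longlonglongrightarrow> fls_nth G k" for k
    using tendsto_fls_nth_poly_mult[where F = "\<lambda>p. laurent_expansion (f p)" and V = V, OF lim]
    by (simp only: G_def)
  have G0: "fls_nth G k = 0" if "k < 0 \<or> k > int M" for k
  proof -
    have "fls_nth (fls_of_poly (H p)) k = 0" for p
      using that deg[of p] by (auto simp: fls_of_poly_nth nat_less_iff intro!: coeff_eq_0)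
    then show ?thesis
      using G[of k] by (simp add: LIMSEQ_const_iff)
  qed
  define h where "h = Poly (map (\<lambda>i. fls_nth G (int i)) [0..<Suc M])"
  have coeff_h: "poly.coeff h i = fls_nth G (int i)" for i
    using G0[of "int i"] by (auto simp: h_def coeff_Poly_eq nth_default_def simp del: upt_Suc)
  have deg_h: "degree h \<le> M"
    using G0 by (auto intro!: degree_le simp: coeff_h)
  have "G = fls_of_poly h"
    using G0 by (intro fls_eqI) (auto simp: fls_of_poly_nth coeff_h)
  then have "laurent_expansion g = laurent_expansion (Fract h V)"
    using V(1) by (simp add: laurent_expansion_Fract G_def field_simps)
  then have g: "g = Fract h V"
    by (simp add: laurent_expansion_inject)
  have poly_sum: "poly q x = (\<Sum>i\<le>M. poly.coeff q i * x ^ i)" if "degree q \<le> M" for q and x :: complex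
    unfolding poly_altdef using that by (intro sum.mono_neutral_left) (auto simp: coeff_eq_0)
  have "(\<lambda>p. poly.coeff (H p) i) \<longlonglongrightarrow> poly.coeff h i" for i
    using G[of "int i"] by (simp add: fls_of_poly_nth coeff_h)
  then have "(\<lambda>p. poly (H p) x) \<longlonglongrightarrow> poly h x" for x
    unfolding poly_sum[OF deg] poly_sum[OF deg_h] by (auto intro!: tendsto_intros)
  then show ?thesis
    unfolding converges_on_def f g
    by (auto simp: V ratfun_eval_Fract intro!: regular_at_Fract tendsto_intros)
qed

section \<open>Iterating the transformation\<close>

lemma fls_nth_bisect_iter:
  "fls_nth (laurent_expansion ((bisect ^^ p) R)) k =
     fls_nth (laurent_expansion R) (2 ^ p * (k + 1) - 1)"
  by (induction p arbitrary: k) (simp_all add: bisect_expansion algebra_simps)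

text \<open>With \<open>V(x) W(x) = V(x\<^sup>2)\<close> the fraction \<open>H / V\<close> is \<open>H W / V(x\<^sup>2)\<close>, whose denominator is even. The
  transformation then only acts on the numerator \<open>H W\<close>, where taking the odd part halves the degree.\<close>

lemma bisect_Fract:
  assumes V: "V \<noteq> 0" and W: "V * W = pcompose V [:0, 0, 1:]"
  shows "\<exists>T. bisect (Fract H V) = Fract T V \<and> 2 * degree T \<le> degree H + degree W"
proof -
  define N where "N = H * W"
  define T where "T = Poly (map (\<lambda>k. poly.coeff N (2 * k + 1)) [0..<Suc (degree N)])"
  have T: "poly.coeff T k = poly.coeff N (2 * k + 1)" for k
    by (auto simp: T_def coeff_Poly_eq nth_default_def coeff_eq_0 simp del: upt_Suc)
  have "2 * degree T \<le> degree N"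
  proof (cases "T = 0")
    case False
    then have "poly.coeff N (2 * degree T + 1) \<noteq> 0"
      using T[of "degree T"] by (metis leading_coeff_0_iff)
    then show ?thesis using le_degree by fastforce
  qed simp
  also have "\<dots> \<le> degree H + degree W"
    unfolding N_def by (rule degree_mult_le)
  finally have deg: "2 * degree T \<le> degree H + degree W" .
  define F where "F = laurent_expansion (Fract H V)"
  have "F * fls_of_poly (V * W) = fls_of_poly N"
    using V by (simp add: F_def N_def laurent_expansion_Fract)
  then have "odd_part F * fls_of_poly V = odd_part (fls_of_poly N)"
    by (metis W odd_part_mult_even)
  also have "\<dots> = fls_of_poly T"
    by (rule fls_eqI) (auto simp: fls_of_poly_nth T nat_add_distrib nat_mult_distrib)
  finally have "odd_part F = laurent_expansion (Fract T V)"
    using V by (simp add: laurent_expansion_Fract field_simps)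
  then have "laurent_expansion (bisect (Fract H V)) = laurent_expansion (Fract T V)"
    by (metis F_def bisect_expansion fls_eqI odd_part_nth)
  then show ?thesis
    using deg laurent_expansion_inject by blast
qed

text \<open>A degree of at most \<open>M\<close> is preserved, since \<open>(M + M) / 2 = M\<close>.\<close>

lemma bisect_iter_Fract:
  assumes "V \<noteq> 0" "V * W = pcompose V [:0, 0, 1:]" "degree W \<le> M" "degree H \<le> M"
  shows "\<exists>T. (bisect ^^ p) (Fract H V) = Fract T V \<and> degree T \<le> M"
proof (induction p)
  case (Suc p)
  then obtain T where T: "(bisect ^^ p) (Fract H V) = Fract T V" "degree T \<le> M" by blast
  obtain U where "bisect (Fract T V) = Fract U V" "2 * degree U \<le> degree T + degree W"
    using bisect_Fract[OF assms(1,2)] by blast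
  then show ?case using T assms(3) by (intro exI[of _ U]) auto
qed (use assms in auto)

section \<open>Asymptotics of denumerants\<close>

lemma abs_power_diff_le:
  fixes u v T :: real
  assumes "0 \<le> u" "u \<le> T" "0 \<le> v" "v \<le> T"
  shows "\<bar>u ^ n - v ^ n\<bar> \<le> n * \<bar>u - v\<bar> * T ^ (n - 1)"
proof (induction n)
  case (Suc n)
  have "u ^ Suc n - v ^ Suc n = u * (u ^ n - v ^ n) + (u - v) * v ^ n"
    by (simp add: algebra_simps)
  then have "\<bar>u ^ Suc n - v ^ Suc n\<bar> \<le> \<bar>u\<bar> * \<bar>u ^ n - v ^ n\<bar> + \<bar>u - v\<bar> * \<bar>v ^ n\<bar>"
    by (metis abs_mult abs_triangle_ineq)
  also have "\<dots> \<le> T * (n * \<bar>u - v\<bar> * T ^ (n - 1)) + \<bar>u - v\<bar> * T ^ n"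
    using assms Suc.IH by (intro add_mono mult_mono) (auto intro: power_mono)
  also have "\<dots> = Suc n * \<bar>u - v\<bar> * T ^ (Suc n - 1)"
    by (cases n) (simp_all add: algebra_simps)
  finally show ?case .
qed simp

text \<open>Modulo \<open>d\<close> the multiples of \<open>m\<close> run through the multiples of \<open>gcd d m\<close> exactly once in each
  period, which consists of \<open>lcm d m div m\<close> steps.\<close>

lemma ex1_shift_into_multiples:
  fixes d m t :: nat
  assumes "d > 0" "m > 0" "gcd d m dvd t" "t \<ge> lcm d m"
  shows "\<exists>!i. i < lcm d m div m \<and> d dvd t - i * m"
proof -
  define g where "g = gcd d m"
  define q where "q = lcm d m div m"
  have qm: "q * m = lcm d m" by (simp add: q_def)
  have g: "g > 0" using assms by (simp add: g_def)
  have "lcm d m * g = d * m" by (simp add: g_def mult.commute)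
  then have "(q * g) * m = d * m" by (simp add: qm[symmetric] mult_ac)
  then have d: "d = q * g" using assms(2) by simp
  then have q: "q > 0" using assms(1) by auto
  define m' where "m' = m div g"
  have m': "m = m' * g" by (simp add: m'_def g_def)
  have cop: "coprime m' q"
  proof -
    have "coprime (d div g) (m div g)"
      unfolding g_def using assms(1) by (intro div_gcd_coprime) simp
    then show ?thesis using d g by (simp add: m'_def coprime_commute)
  qed
  define t' where "t' = t div g"
  have t': "t = t' * g" using assms(3) by (simp add: t'_def g_def)
  have dvd_iff: "d dvd t - i * m \<longleftrightarrow> [i * m' = t'] (mod q)" if "i < q" for i
  proof -
    have "i * m \<le> t"
      using that qm assms(4) by (metis le_trans less_imp_le mult_le_mono1)
    then have le: "i * m' \<le> t'" using g by (simp add: m' t' flip: mult.assoc)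
    have "t - i * m = (t' - i * m') * g" by (simp add: m' t' diff_mult_distrib)
    then have "d dvd t - i * m \<longleftrightarrow> q dvd t' - i * m'" using g d by simp
    also have "\<dots> \<longleftrightarrow> [t' = i * m'] (mod q)"
      using le by (simp add: cong_altdef_nat)
    finally show ?thesis by (simp add: cong_sym_eq)
  qed
  obtain v where v: "[m' * v = 1] (mod q)" using cop cong_solve_coprime_nat by auto
  show ?thesis
    unfolding q_def[symmetric]
  proof (rule ex1I)
    have "[(v * t') mod q * m' = v * t' * m'] (mod q)"
      by (intro cong_scalar_right) simp
    also have "[v * t' * m' = 1 * t'] (mod q)"
      using cong_scalar_right[OF v, of t'] by (simp add: mult_ac)
    finally show "(v * t') mod q < q \<and> d dvd t - (v * t') mod q * m"
      using q by (simp add: dvd_iff)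
  next
    fix i assume i: "i < q \<and> d dvd t - i * m"
    then have "[i * m' = t'] (mod q)" using dvd_iff by blast
    from cong_scalar_right[OF this, of v] have "[i * (m' * v) = v * t'] (mod q)"
      by (simp add: mult_ac)
    moreover have "[i * (m' * v) = i * 1] (mod q)" by (rule cong_scalar_left[OF v])
    ultimately have "[i = v * t'] (mod q)"
      by (metis cong_sym cong_trans mult.right_neutral)
    then show "i = (v * t') mod q" using i by (simp add: cong_def)
  qed
qed

text \<open>Multiplying a power series by \<open>1 / (1 - x\<^sup>m)\<close> turns its coefficients \<open>a\<close> into a sequence \<open>b\<close> with
  \<open>b(t) = a(t) + b(t - m)\<close>. If \<open>gcd d m\<close> divides \<open>t\<close>, exactly one of the summands
  \<open>a(t - i m)\<close> over a full period \<open>l = lcm d m\<close> has its main term, so \<open>b(t) - b(t - l)\<close> is about \<open>c t\<^sup>n\<close>, which is also the increment of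
  \<open>c t\<^sup>n\<^sup>+\<^sup>1 / (l (n + 1))\<close>. The errors add up to the next order. The factor \<open>n\<close> in
  the error bound makes it vanish for \<open>n = 0\<close>; a bounded error in that case would
  be as large as the main term.\<close>

lemma denumerant_asymptotics_step:
  fixes a b :: "nat \<Rightarrow> complex" and c :: complex and C :: real and m d n :: nat
  assumes m: "m > 0" and d: "d > 0"
    and b: "\<And>t. t \<ge> m \<Longrightarrow> b t = a t + b (t - m)"
    and a: "\<And>t. norm (a t - (if d dvd t then c * of_nat t ^ n else 0)) \<le> C * n * real (t + 1) ^ (n - 1)"
  shows "\<exists>C' :: real. \<forall>t. norm (b t - (if gcd d m dvd t
            then c / of_nat (lcm d m * (n + 1)) * of_nat t ^ (n + 1) else 0))
          \<le> C' * (n + 1) * real (t + 1) ^ n"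
proof -
  define l where "l = lcm d m"
  define q where "q = l div m"
  define g where "g = gcd d m"
  define c' where "c' = c / of_nat (l * (n + 1))"
  define \<mu> where "\<mu> t = (if d dvd t then c * of_nat t ^ n else 0)" for t
  define D where "D t = b t - (if g dvd t then c' * of_nat t ^ (n + 1) else 0)" for t
  define K where "K = q * \<bar>C\<bar> + norm c * l"
  have l: "l > 0" "q * m = l" using m d by (simp_all add: l_def q_def lcm_pos_nat)
  have gl: "g dvd l" by (simp add: g_def l_def)
  have tel: "b t = (\<Sum>i<r. a (t - i * m)) + b (t - r * m)" if "t \<ge> r * m" for t r
    using that
  proof (induction r)
    case (Suc r)
    then have "b (t - r * m) = a (t - r * m) + b (t - Suc r * m)"
      using b[of "t - r * m"] by (simp add: algebra_simps)
    with Suc show ?case by simp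
  qed simp
  have main: "norm ((\<Sum>i<q. \<mu> (t - i * m)) -
      (if g dvd t then c' * (of_nat t ^ (n + 1) - of_nat (t - l) ^ (n + 1)) else 0))
      \<le> norm c * l * n * real (t + 1) ^ (n - 1)" if t: "t \<ge> l" for t
  proof (cases "g dvd t")
    case False
    have "\<mu> (t - i * m) = 0" if "i < q" for i
    proof -
      have "i * m \<le> t" using that l t by (metis le_trans less_imp_le mult_le_mono1)
      then have "\<not> g dvd t - i * m"
        using False by (metis dvd_diffD g_def gcd_dvd2 dvd_mult)
      then show ?thesis by (auto simp: \<mu>_def g_def intro: dvd_trans)
    qed
    then show ?thesis using False by simp
  next
    case True
    then have "\<exists>!i. i < q \<and> d dvd t - i * m"
      using ex1_shift_into_multiples[OF d m, of t] t unfolding q_def l_def g_def by blast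
    then obtain i where i: "i < q" "d dvd t - i * m"
      and unique: "\<And>k. k < q \<Longrightarrow> d dvd t - k * m \<Longrightarrow> k = i"
      by blast
    have mu: "\<mu> (t - k * m) = (if k = i then c * of_nat (t - i * m) ^ n else 0)" if "k < q" for k
    proof (cases "k = i")
      case False
      then have "\<not> d dvd t - k * m" using unique[OF that] by blast
      then show ?thesis using False by (simp add: \<mu>_def)
    qed (simp add: \<mu>_def i(2))
    have "(\<Sum>k<q. \<mu> (t - k * m)) = (\<Sum>k<q. if k = i then c * of_nat (t - i * m) ^ n else 0)"
      by (intro sum.cong refl mu) simp
    also have "\<dots> = c * of_real (real (t - i * m) ^ n)" using i by simp
    finally have s: "(\<Sum>k<q. \<mu> (t - k * m)) = c * of_real (real (t - i * m) ^ n)" .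
    \<comment> \<open>By the mean value theorem the difference quotient is, up to the factor \<open>n + 1\<close>, the \<open>n\<close>-th power
      of a point \<open>z\<close> in the interval \<open>[t - l, t]\<close>, which also contains \<open>t - i m\<close>.\<close>
    have "\<exists>z. real (t - l) < z \<and> z < real t \<and>
        real t ^ (n + 1) - real (t - l) ^ (n + 1) = (real t - real (t - l)) * (real (n + 1) * z ^ n)"
      using l t by (intro MVT2) (auto intro!: derivative_eq_intros simp del: power_Suc)
    then obtain z where z: "real (t - l) < z" "z < real t"
        "real t ^ (n + 1) - real (t - l) ^ (n + 1) = real l * (real (n + 1) * z ^ n)"
      using t by (auto simp: of_nat_diff)
    have "c' * (of_nat t ^ (n + 1) - of_nat (t - l) ^ (n + 1)) =
        c' * of_real (real t ^ (n + 1) - real (t - l) ^ (n + 1))"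
      by (simp only: of_real_diff of_real_power of_real_of_nat_eq)
    also have "\<dots> = c' * of_nat (l * (n + 1)) * of_real (z ^ n)"
      unfolding z(3) by (simp only: of_real_mult of_real_of_nat_eq of_nat_mult mult_ac)
    also have "c' * of_nat (l * (n + 1)) = c"
      using l by (simp add: c'_def del: of_nat_mult of_nat_add of_nat_Suc)
    finally have e: "c' * (of_nat t ^ (n + 1) - of_nat (t - l) ^ (n + 1)) = c * of_real (z ^ n)" .
    have il: "i * m \<le> l" using i l by (metis less_imp_le mult_le_mono1)
    then have "real (t - l) \<le> real (t - i * m)" "real (t - i * m) \<le> real t"
      by (simp_all only: of_nat_le_iff diff_le_mono2 diff_le_self)
    moreover have "real (t - l) = real t - real l" using t by (simp add: of_nat_diff)
    ultimately have dist: "\<bar>real (t - i * m) - z\<bar> \<le> l"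
      using z(1,2) by linarith
    have "\<bar>real (t - i * m) ^ n - z ^ n\<bar> \<le> n * \<bar>real (t - i * m) - z\<bar> * real t ^ (n - 1)"
      using z by (intro abs_power_diff_le) auto
    also have "\<dots> \<le> n * real l * real (t + 1) ^ (n - 1)"
      using dist by (intro mult_mono power_mono) auto
    finally have "norm c * \<bar>real (t - i * m) ^ n - z ^ n\<bar> \<le> norm c * (n * real l * real (t + 1) ^ (n - 1))"
      by (intro mult_left_mono) auto
    moreover have "norm (c * of_real (real (t - i * m) ^ n) - c * of_real (z ^ n)) =
        norm c * \<bar>real (t - i * m) ^ n - z ^ n\<bar>"
      by (simp only: right_diff_distrib[symmetric] of_real_diff[symmetric] norm_mult norm_of_real)
    moreover have "norm c * (n * real l * real (t + 1) ^ (n - 1)) = norm c * l * n * real (t + 1) ^ (n - 1)"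
      by simp
    ultimately show ?thesis using True by (simp only: s e if_True)
  qed
  have step: "norm (D t - D (t - l)) \<le> K * n * real (t + 1) ^ (n - 1)" if t: "t \<ge> l" for t
  proof -
    have gt: "g dvd t - l \<longleftrightarrow> g dvd t"
      using gl t by (metis dvd_diffD dvd_diff_nat)
    define E where
      "E = (if g dvd t then c' * (of_nat t ^ (n + 1) - of_nat (t - l) ^ (n + 1)) else 0)"
    have "D t - D (t - l) = (b t - b (t - l)) - E"
      unfolding D_def gt E_def by (simp only: right_diff_distrib split: if_splits) simp
    also have "b t - b (t - l) = (\<Sum>i<q. a (t - i * m))"
      using tel[of q t] t l by simp
    also have "\<dots> - E = (\<Sum>i<q. a (t - i * m) - \<mu> (t - i * m)) + ((\<Sum>i<q. \<mu> (t - i * m)) - E)"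
      unfolding sum_subtractf by simp
    also have "norm \<dots> \<le> (\<Sum>i<q. \<bar>C\<bar> * n * real (t + 1) ^ (n - 1)) + norm c * l * n * real (t + 1) ^ (n - 1)"
    unfolding E_def
    proof (intro norm_triangle_mono main t sum_norm_le)
      fix i
      have "norm (a (t - i * m) - \<mu> (t - i * m)) \<le> C * n * real ((t - i * m) + 1) ^ (n - 1)"
        unfolding \<mu>_def by (rule a)
      also have "\<dots> \<le> \<bar>C\<bar> * n * real (t + 1) ^ (n - 1)"
        by (intro mult_mono power_mono of_nat_mono) auto
      finally show "norm (a (t - i * m) - \<mu> (t - i * m)) \<le> \<bar>C\<bar> * n * real (t + 1) ^ (n - 1)" .
    qed
    also have "\<dots> = K * n * real (t + 1) ^ (n - 1)" by (simp add: K_def algebra_simps)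
    finally show ?thesis .
  qed
  \<comment> \<open>The sum bounds the initial values below one period; the other part absorbs the increments.\<close>
  define C' where "C' = K * n + (\<Sum>t<l. norm (D t))"
  have C': "C' \<ge> K * n" "C' \<ge> 0" unfolding C'_def K_def
    by (auto intro!: sum_nonneg add_nonneg_nonneg mult_nonneg_nonneg)
  have bound: "norm (D t) \<le> C' * real (t + 1) ^ n" for t
  proof (induction t rule: less_induct)
    case (less t)
    show ?case
    proof (cases "t < l")
      case True
      then have "norm (D t) \<le> (\<Sum>t<l. norm (D t))"
        by (intro member_le_sum) auto
      also have "\<dots> \<le> C'" by (simp add: C'_def K_def)
      also have "\<dots> \<le> C' * real (t + 1) ^ n"
        using mult_left_mono[OF one_le_power[of "real (t + 1)" n] C'(2)] by simp
      finally show ?thesis .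
    next
      case False
      have "norm (D t) \<le> norm (D (t - l)) + norm (D t - D (t - l))"
        by (metis add_diff_cancel_left' diff_add_cancel norm_triangle_ineq add.commute)
      also have "\<dots> \<le> C' * real (t - l + 1) ^ n + K * n * real (t + 1) ^ (n - 1)"
        using False l by (intro add_mono less.IH step) auto
      also have "\<dots> \<le> C' * real (t + 1) ^ n"
      proof (cases n)
        case (Suc k)
        have "real (t - l + 1) ^ n \<le> real (t - l + 1) * real (t + 1) ^ k"
          unfolding Suc power_Suc by (intro mult_left_mono power_mono) auto
        also have "\<dots> \<le> real t * real (t + 1) ^ k"
          using False l by (intro mult_right_mono) auto
        also have "\<dots> = real (t + 1) ^ n - real (t + 1) ^ k"
          by (simp add: Suc algebra_simps)
        finally have "C' * real (t - l + 1) ^ n \<le> C' * (real (t + 1) ^ n - real (t + 1) ^ k)"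
          using C' by (intro mult_left_mono) auto
        moreover have "K * n * real (t + 1) ^ k \<le> C' * real (t + 1) ^ k"
          using C' by (intro mult_right_mono) auto
        ultimately show ?thesis by (simp add: Suc algebra_simps)
      qed simp
      finally show ?thesis .
    qed
  qed
  show ?thesis
  proof (intro exI allI)
    fix t
    have "C' * real (t + 1) ^ n \<le> C' * (n + 1) * real (t + 1) ^ n"
      using C'(2) by (intro mult_right_mono) (auto simp: algebra_simps)
    with bound[of t] show "norm (b t - (if gcd d m dvd t
            then c / of_nat (lcm d m * (n + 1)) * of_nat t ^ (n + 1) else 0))
          \<le> C' * (n + 1) * real (t + 1) ^ n"
      unfolding D_def c'_def g_def l_def by linarith
  qed
qed

text \<open>The generating function of the denumerant: the \<open>t\<close>-th coefficient counts the tuples of nonnegative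
  integers \<open>i\<^sub>1, \<dots>, i\<^sub>n\<close> with \<open>\<Sum>\<^sub>k i\<^sub>k m\<^sub>k = t\<close>.\<close>

definition coin_series :: "nat \<Rightarrow> (nat \<Rightarrow> nat) \<Rightarrow> complex fps" where
  "coin_series n m = (\<Prod>k\<in>{1..n}. inverse (1 - fps_X ^ m k))"

lemma coin_series_Suc_nth:
  assumes "m (Suc n) > 0"
  shows "fps_nth (coin_series (Suc n) m) t = fps_nth (coin_series n m) t +
           (if t < m (Suc n) then 0 else fps_nth (coin_series (Suc n) m) (t - m (Suc n)))"
proof -
  have "coin_series (Suc n) m = coin_series n m * inverse (1 - fps_X ^ m (Suc n))"
    by (simp add: coin_series_def)
  then have "coin_series (Suc n) m * (1 - fps_X ^ m (Suc n)) = coin_series n m"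
    using assms by (simp add: mult.assoc inverse_mult_eq_1)
  then have "coin_series (Suc n) m = coin_series n m + coin_series (Suc n) m * fps_X ^ m (Suc n)"
    by (simp add: algebra_simps)
  then have "fps_nth (coin_series (Suc n) m) t =
      fps_nth (coin_series n m + coin_series (Suc n) m * fps_X ^ m (Suc n)) t"
    by simp
  then show ?thesis by (simp only: fps_add_nth fps_X_power_mult_right_nth)
qed

lemma coin_series_1_nth:
  assumes "m 1 > 0"
  shows "fps_nth (coin_series 1 m) t = (if m 1 dvd t then 1 else 0)"
proof (induction t rule: less_induct)
  case (less t)
  have "fps_nth (coin_series 1 m) t = (if t = 0 then 1 else 0) +
           (if t < m 1 then 0 else fps_nth (coin_series 1 m) (t - m 1))"
    using coin_series_Suc_nth[of m 0 t] assms by (simp add: coin_series_def)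
  moreover have "fps_nth (coin_series 1 m) (t - m 1) = (if m 1 dvd t then 1 else 0)" if "m 1 \<le> t"
    using less[of "t - m 1"] that assms by (simp add: dvd_minus_self)
  ultimately show ?case
    using assms by (auto simp: nat_dvd_not_less)
qed

text \<open>Each new part \<open>M\<close> replaces the gcd \<open>d\<close> of the parts by \<open>gcd d M\<close> and divides the leading coefficient
  by \<open>lcm d M\<close> and by the new exponent; \<open>gcd d M * lcm d M = d * M\<close> keeps the coefficient in the form
  \<open>gcd / (product \<cdot> factorial)\<close>.\<close>

lemma coin_series_asymptotics:
  assumes "n \<ge> 1" "\<And>k. k \<in> {1..n} \<Longrightarrow> m k > 0"
  defines "d \<equiv> Gcd (m ` {1..n})"
  shows "\<exists>C :: real. \<forall>t. norm (fps_nth (coin_series n m) t -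
            (if d dvd t then of_nat d / of_nat ((\<Prod>k\<in>{1..n}. m k) * fact (n - 1)) * of_nat t ^ (n - 1) else 0))
          \<le> C * real (n - 1) * real (t + 1) ^ (n - 1 - 1)"
  using assms(1,2) unfolding d_def
proof (induction n rule: dec_induct)
  case base
  then have "m 1 > 0" by auto
  then show ?case using coin_series_1_nth[of m] by (intro exI[of _ 0]) auto
next
  case (step n)
  define d where "d = Gcd (m ` {1..n})"
  define P where "P = (\<Prod>k\<in>{1..n}. m k)"
  define M where "M = m (Suc n)"
  have pos: "M > 0" "P > 0" using step.prems by (auto simp: M_def P_def intro!: prod_pos)
  have "m 1 \<in> m ` {1..n}" "m 1 > 0" using step by auto
  then have "d > 0" unfolding d_def by (metis Gcd_dvd dvd_0_left_iff gr0I)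
  obtain k where k: "n = Suc k" using step.hyps by (cases n) auto
  have ins: "{1..Suc n} = insert (Suc n) {1..n}" by auto
  have gcd: "Gcd (m ` {1..Suc n}) = gcd d M"
    unfolding ins by (simp add: d_def M_def gcd.commute)
  have P: "(\<Prod>k\<in>{1..Suc n}. m k) = P * M" by (simp add: P_def M_def)
  from step.IH step.prems obtain C :: real where C: "\<And>t. norm (fps_nth (coin_series n m) t -
      (if d dvd t then of_nat d / of_nat (P * fact (n - 1)) * of_nat t ^ (n - 1) else 0))
      \<le> C * real (n - 1) * real (t + 1) ^ (n - 1 - 1)"
    unfolding d_def P_def by (metis atLeastAtMost_iff le_SucI)
  have const: "of_nat d / of_nat (P * fact (n - 1)) / of_nat (lcm d M * (n - 1 + 1)) =
      (of_nat (gcd d M) / of_nat (P * M * fact (Suc n - 1)) :: complex)"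
  proof -
    have div_eq: "a / (p * f) / (l * x) = g / (p * q * (f * x))"
      if "g * l = a * q" "l \<noteq> 0" "q \<noteq> 0" for a p f l x g q :: complex
      using that by (cases "p = 0 \<or> f = 0 \<or> x = 0") (auto simp: field_simps)
    have "of_nat (gcd d M) * of_nat (lcm d M) = (of_nat d * of_nat M :: complex)"
      by (simp flip: of_nat_mult)
    moreover have "of_nat (lcm d M) \<noteq> (0 :: complex)" "of_nat M \<noteq> (0 :: complex)"
      using pos \<open>d > 0\<close> by (simp_all add: lcm_pos_nat)
    moreover have "fact (Suc n - 1) = fact (n - 1) * (n - 1 + 1)"
      by (simp add: k)
    ultimately show ?thesis
      by (simp only: of_nat_mult) (rule div_eq)
  qed
  have "\<exists>C' :: real. \<forall>t. norm (fps_nth (coin_series (Suc n) m) t - (if gcd d M dvd t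
            then of_nat d / of_nat (P * fact (n - 1)) / of_nat (lcm d M * (n - 1 + 1)) * of_nat t ^ (n - 1 + 1) else 0))
          \<le> C' * (n - 1 + 1) * real (t + 1) ^ (n - 1)"
  proof (rule denumerant_asymptotics_step[OF pos(1) \<open>d > 0\<close> _ C])
    show "fps_nth (coin_series (Suc n) m) t =
        fps_nth (coin_series n m) t + fps_nth (coin_series (Suc n) m) (t - M)" if "t \<ge> M" for t
      using coin_series_Suc_nth[of m n t] pos(1) that by (simp add: M_def)
  qed
  then show ?case
    unfolding const gcd P by (simp only: k Suc_eq_plus1 add_diff_cancel_right')
qed

text \<open>The form in which the asymptotics are applied: \<open>s\<close> is an arithmetic expression of size about
  \<open>r N\<close> whose divisibility by the gcd eventually does not vary.\<close>

lemma coin_series_limit: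
  fixes N :: "nat \<Rightarrow> nat" and s :: "nat \<Rightarrow> nat"
  assumes "n \<ge> 1" "\<And>k. k \<in> {1..n} \<Longrightarrow> m k > 0"
    and N: "filterlim N at_top sequentially" "\<And>p. N p > 0"
    and s: "filterlim s at_top sequentially"
    and ratio: "(\<lambda>p. real (s p) / real (N p)) \<longlonglongrightarrow> r"
    and res: "eventually (\<lambda>p. Gcd (m ` {1..n}) dvd s p \<longleftrightarrow> Q) sequentially"
  shows "(\<lambda>p. fps_nth (coin_series n m) (s p) / of_nat (N p) ^ (n - 1)) \<longlonglongrightarrow>
     (if Q then of_nat (Gcd (m ` {1..n})) / of_nat ((\<Prod>k\<in>{1..n}. m k) * fact (n - 1)) *
       of_real (r ^ (n - 1)) else 0)"
proof -
  define d where "d = Gcd (m ` {1..n})"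
  define c where "c = (of_nat d / of_nat ((\<Prod>k\<in>{1..n}. m k) * fact (n - 1)) :: complex)"
  obtain C :: real where C: "\<And>t. norm (fps_nth (coin_series n m) t -
      (if d dvd t then c * of_nat t ^ (n - 1) else 0)) \<le> C * real (n - 1) * real (t + 1) ^ (n - 1 - 1)"
    using coin_series_asymptotics[of n m] assms(1,2) unfolding d_def c_def by blast
  define err where "err t = fps_nth (coin_series n m) t - (if d dvd t then c * of_nat t ^ (n - 1) else 0)" for t
  have inv: "(\<lambda>p. 1 / real (N p)) \<longlonglongrightarrow> 0"
    using N(1) filterlim_compose[OF lim_1_over_n] by blast
  define B where "B p = C * real (n - 1) * (real (s p) / real (N p) + 1 / real (N p)) ^ (n - 1 - 1) *
      (1 / real (N p))" for p
  have "B \<longlonglongrightarrow> C * real (n - 1) * (r + 0) ^ (n - 1 - 1) * 0"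
    unfolding B_def by (intro tendsto_intros ratio inv)
  then have *: "B \<longlonglongrightarrow> 0"
    by simp
  have "(\<lambda>p. err (s p) / of_nat (N p) ^ (n - 1)) \<longlonglongrightarrow> 0"
  proof (rule tendsto_0_le[OF * always_eventually, where K = 1], intro allI)
    fix p
    have "norm (err (s p) / of_nat (N p) ^ (n - 1)) \<le> C * real (n - 1) * real (s p + 1) ^ (n - 1 - 1) / real (N p) ^ (n - 1)"
      using C[of "s p"] by (simp add: err_def norm_divide norm_power divide_right_mono)
    also have "\<dots> = B p"
    proof (cases "n - 1")
      case (Suc k)
      have "real (s p) / real (N p) + 1 / real (N p) = real (s p + 1) / real (N p)"
        by (simp add: add_divide_distrib)
      then show ?thesis by (simp only: B_def Suc diff_Suc_1) (simp add: power_divide)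
    qed (simp add: B_def)
    also have "\<dots> \<le> norm (B p) * 1" by simp
    finally show "norm (err (s p) / of_nat (N p) ^ (n - 1)) \<le> norm (B p) * 1" .
  qed
  moreover have "(\<lambda>p. (if Q then c else 0) * of_real ((real (s p) / real (N p)) ^ (n - 1))) \<longlonglongrightarrow>
      (if Q then c else 0) * of_real (r ^ (n - 1))"
    by (intro tendsto_intros ratio)
  ultimately have "(\<lambda>p. err (s p) / of_nat (N p) ^ (n - 1) +
      (if Q then c else 0) * of_real ((real (s p) / real (N p)) ^ (n - 1))) \<longlonglongrightarrow>
      0 + (if Q then c else 0) * of_real (r ^ (n - 1))"
    by (rule tendsto_add)
  moreover have "eventually (\<lambda>p. err (s p) / of_nat (N p) ^ (n - 1) +
      (if Q then c else 0) * of_real ((real (s p) / real (N p)) ^ (n - 1)) =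
      fps_nth (coin_series n m) (s p) / of_nat (N p) ^ (n - 1)) sequentially"
    using res unfolding d_def[symmetric]
    by eventually_elim (auto simp: err_def power_divide diff_divide_distrib)
  ultimately have "(\<lambda>p. fps_nth (coin_series n m) (s p) / of_nat (N p) ^ (n - 1)) \<longlonglongrightarrow>
      0 + (if Q then c else 0) * of_real (r ^ (n - 1))"
    by (rule Lim_transform_eventually)
  then show ?thesis
    by (cases Q) (simp_all only: c_def d_def if_True if_False add_0 mult_zero_left)
qed

section \<open>Orbits of the maps \<open>\<gamma>\<^sub>d\<close>\<close>

text \<open>On \<open>i + 1\<close> the map is division by \<open>2\<close> modulo \<open>d\<close>, which is why residues along an orbit
  are governed by powers of \<open>2\<close>.\<close>

lemma gamma_map_double:
  assumes "odd d"
  shows "2 * (gamma_map d i + 1) = (if even i then i + 1 + int d else i + 1)"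
  using assms by (auto simp: gamma_map_def elim!: oddE evenE)

lemma cong_gamma_map_iter:
  assumes "odd d"
  shows "[2 ^ r * ((gamma_map d ^^ r) i + 1) = i + 1] (mod int d)"
proof (induction r)
  case (Suc r)
  have "[2 * (gamma_map d ((gamma_map d ^^ r) i) + 1) = (gamma_map d ^^ r) i + 1] (mod int d)"
    unfolding gamma_map_double[OF assms] by (auto simp: cong_def)
  from cong_scalar_left[OF this, of "2 ^ r"]
  have "[2 ^ Suc r * ((gamma_map d ^^ Suc r) i + 1) = 2 ^ r * ((gamma_map d ^^ r) i + 1)] (mod int d)"
    by (simp only: power_Suc2 mult.assoc funpow.simps o_apply)
  then show ?case using Suc.IH by (rule cong_trans)
qed simp

lemma gcd_gamma_map_iter:
  assumes "odd d"
  shows "gcd ((gamma_map d ^^ r) i + 1) (int d) = gcd (i + 1) (int d)"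
proof -
  have "gcd (i + 1) (int d) = gcd (2 ^ r * ((gamma_map d ^^ r) i + 1)) (int d)"
    using cong_gcd_eq[OF cong_gamma_map_iter[OF assms, of r i]] by (simp add: gcd.commute)
  also have "\<dots> = gcd ((gamma_map d ^^ r) i + 1) (int d)"
    using assms by (intro gcd_mult_left_left_cancel) auto
  finally show ?thesis ..
qed

lemma dvd_gamma_map_iter:
  assumes "odd d"
  shows "int d dvd (gamma_map d ^^ r) i + 1 \<longleftrightarrow> int d dvd i + 1"
proof -
  have "int d dvd a \<longleftrightarrow> gcd a (int d) = int d" for a
    by (metis gcd_dvd1 gcd_proj2_if_dvd_int abs_of_nat)
  then show ?thesis by (simp only: gcd_gamma_map_iter[OF assms])
qed

lemma rho_gamma_map_iter:
  assumes "odd d"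
  shows "rho d ((gamma_map d ^^ r) i) = rho d i"
  by (simp only: rho_def gcd_gamma_map_iter[OF assms])

lemma gamma_map_iter_range:
  assumes "odd d" "i \<in> {0..int d - 1}"
  shows "(gamma_map d ^^ r) i \<in> {0..int d - 1}"
proof (induction r)
  case (Suc r)
  then show ?case
    using gamma_map_double[OF assms(1), of "(gamma_map d ^^ r) i"] by (auto split: if_splits elim!: evenE oddE)
qed (use assms in auto)

text \<open>On the residue class of \<open>-1\<close> the sign is invariant. It decides which of the two fixed points
  \<open>-1\<close> and \<open>d - 1\<close> attracts \<open>i\<close>. For other residues negative integers can become nonnegative.\<close>

lemma gamma_map_iter_negative_iff:
  assumes "odd d" "int d dvd i + 1"
  shows "(gamma_map d ^^ r) i < 0 \<longleftrightarrow> i < 0"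
proof (induction r)
  case (Suc r)
  define k where "k = (gamma_map d ^^ r) i"
  have "int d dvd k + 1"
    using assms dvd_gamma_map_iter by (simp add: k_def)
  then obtain u where u: "k + 1 = int d * u" ..
  have d: "int d > 0" using assms(1) by (auto elim!: oddE)
  \<comment> \<open>An even \<open>k\<close> makes \<open>u\<close> odd, so a negative \<open>k\<close> gives \<open>u \<le> -1\<close>, and adding \<open>d\<close> does not cross \<open>0\<close>.\<close>
  have "gamma_map d k < 0 \<longleftrightarrow> k < 0"
  proof (cases "even k")
    case True
    then have "odd u" using u by (metis even_mult_iff even_plus_one_iff)
    then have "u \<noteq> 0" by auto
    have "2 * (gamma_map d k + 1) = int d * (u + 1)"
      using True gamma_map_double[OF assms(1), of k] u by (simp add: distrib_left)
    moreover have "k < 0 \<longleftrightarrow> int d * u \<le> 0" using u by auto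
    moreover have "gamma_map d k < 0 \<longleftrightarrow> int d * (u + 1) \<le> 0"
      using calculation(1) by auto
    ultimately show ?thesis
      using d \<open>u \<noteq> 0\<close> by (auto simp: mult_le_0_iff)
  next
    case False
    then show ?thesis using gamma_map_double[OF assms(1), of k] by auto
  qed
  then show ?case using Suc.IH by (simp add: k_def)
qed simp

lemma rho_pos:
  assumes "odd d"
  shows "rho d i > 0"
proof -
  define g where "g = nat (gcd (i + 1) (int d))"
  have "g dvd d"
    by (simp add: g_def nat_dvd_iff)
  then have "odd (d div g)"
    using assms by (metis dvd_mult_div_cancel even_mult_iff)
  then show ?thesis
    by (simp add: rho_def flip: g_def)
qed

lemma cong_two_power_rho:
  assumes "odd d" "rho d i dvd r"
  shows "[2 ^ r * (i + 1) = i + 1] (mod int d)"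
proof -
  define g where "g = gcd (i + 1) (int d)"
  define e where "e = d div nat g"
  have g: "g > 0" using assms(1) by (auto simp: g_def gcd_pos_int elim!: oddE)
  have d: "int d = g * int e"
  proof -
    have "g dvd int d" by (simp add: g_def)
    then show ?thesis using g by (simp add: e_def zdiv_int)
  qed
  have "[2 ^ r = 1] (mod e)"
    using assms(2) unfolding ord_divides rho_def e_def g_def .
  then have "[2 ^ r = 1] (mod int e)"
    using cong_int_iff by force
  then obtain s where s: "2 ^ r - 1 = int e * s"
    by (metis cong_iff_dvd_diff dvdE)
  obtain h where h: "i + 1 = g * h" by (metis g_def gcd_dvd1 dvdE)
  have "2 ^ r * (i + 1) - (i + 1) = (2 ^ r - 1) * (i + 1)" by (simp add: algebra_simps)
  also have "\<dots> = int d * (s * h)" by (simp only: s h d mult_ac)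
  finally show ?thesis
    by (simp only: cong_iff_dvd_diff dvd_triv_left)
qed

text \<open>Outside the interval from \<open>-1\<close> to \<open>d - 1\<close> the map strictly decreases the absolute value, unless it
  jumps into the interval.\<close>

lemma gamma_map_iter_enters:
  assumes "odd d"
  shows "\<exists>r. (gamma_map d ^^ r) i \<in> {- 1..int d - 1}"
proof (induction "nat \<bar>i\<bar>" arbitrary: i rule: less_induct)
  case less
  show ?case
  proof (cases "i \<in> {- 1..int d - 1}")
    case True
    then show ?thesis by (intro exI[of _ 0]) simp
  next
    case False
    have d: "int d > 0" using assms by (auto elim!: oddE)
    have g: "2 * (gamma_map d i + 1) = (if even i then i + 1 + int d else i + 1)"
      by (rule gamma_map_double[OF assms])
    have "\<exists>r. (gamma_map d ^^ r) (gamma_map d i) \<in> {- 1..int d - 1}"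
    proof (cases "gamma_map d i \<in> {- 1..int d - 1}")
      case True
      then show ?thesis by (intro exI[of _ 0]) simp
    next
      case out: False
      have "\<bar>gamma_map d i\<bar> < \<bar>i\<bar>"
        using g d False out by (auto split: if_splits)
      then show ?thesis using less.hyps[of "gamma_map d i"] by simp
    qed
    then obtain r where "(gamma_map d ^^ r) (gamma_map d i) \<in> {- 1..int d - 1}" ..
    then show ?thesis
      by (intro exI[of _ "Suc r"]) (simp only: funpow_Suc_right o_apply)
  qed
qed

lemma A_set_imp_dvd:
  assumes "odd d" "j \<in> A_set d"
  shows "int d dvd j + 1"
proof -
  from assms(2) obtain r where "(gamma_map d ^^ r) j \<in> {- 1, int d - 1}"
    by (auto simp: A_set_def E_set_def)
  then have "int d dvd (gamma_map d ^^ r) j + 1" by auto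
  then show ?thesis using dvd_gamma_map_iter[OF assms(1)] by blast
qed

text \<open>Together with the preceding lemma: the set \<open>A\<close> is the residue class of \<open>-1\<close> modulo \<open>d\<close>.\<close>

lemma dvd_imp_A_set:
  assumes "odd d" "int d dvd j + 1"
  shows "j \<in> A_set d"
proof -
  obtain r where r: "(gamma_map d ^^ r) j \<in> {- 1..int d - 1}"
    using gamma_map_iter_enters[OF assms(1)] by blast
  have d: "int d > 0" using assms by (auto elim!: oddE)
  from assms dvd_gamma_map_iter obtain u where u: "(gamma_map d ^^ r) j + 1 = int d * u"
    by (metis dvdE)
  have "0 \<le> int d * u" "int d * u \<le> int d * 1" using r u by auto
  then have "u = 0 \<or> u = 1" using d by (auto simp: zero_le_mult_iff)
  then have "(gamma_map d ^^ r) j \<in> {- 1, int d - 1}" using u by auto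
  then show ?thesis by (auto simp: A_set_def E_set_def)
qed

lemma E_set_minus_one_imp_negative:
  assumes "odd d" "j \<in> E_set d (- 1)"
  shows "j < 0"
proof -
  have "int d dvd j + 1" using assms A_set_imp_dvd by (simp add: A_set_def)
  moreover from assms(2) obtain r where "(gamma_map d ^^ r) j = - 1" by (auto simp: E_set_def)
  ultimately show ?thesis using gamma_map_iter_negative_iff[OF assms(1), of j r] by simp
qed

lemma E_set_top_imp_nonnegative:
  assumes "odd d" "j \<in> E_set d (int d - 1)"
  shows "j \<ge> 0"
proof -
  have "int d dvd j + 1" using assms A_set_imp_dvd by (simp add: A_set_def)
  moreover from assms(2) obtain r where "(gamma_map d ^^ r) j = int d - 1" by (auto simp: E_set_def)
  moreover have "int d > 0" using assms(1) by (auto elim!: oddE)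
  ultimately show ?thesis using gamma_map_iter_negative_iff[OF assms(1), of j r] by simp
qed

text \<open>Once in the interval from \<open>0\<close> to \<open>d - 1\<close> an orbit stays there, and \<open>\<rho>\<close> is constant along it, so the entrance time can be
  extended to a multiple of \<open>\<rho>\<close>.\<close>

lemma gamma_map_iter_enters_in_phase:
  assumes "odd d" "j \<notin> A_set d"
  shows "\<exists>r. (gamma_map d ^^ r) j \<in> {0..int d - 1} \<and> rho d ((gamma_map d ^^ r) j) dvd r"
proof -
  obtain r where r: "(gamma_map d ^^ r) j \<in> {- 1..int d - 1}"
    using gamma_map_iter_enters[OF assms(1)] by blast
  moreover have "(gamma_map d ^^ r) j \<noteq> - 1"
    using assms(2) by (auto simp: A_set_def E_set_def)
  ultimately have r': "(gamma_map d ^^ r) j \<in> {0..int d - 1}" by auto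
  define s where "s = rho d j * r - r"
  have "s + r = r * rho d j"
    using rho_pos[OF assms(1), of j] by (simp add: s_def)
  then have "(gamma_map d ^^ (r * rho d j)) j = (gamma_map d ^^ s) ((gamma_map d ^^ r) j)"
    by (metis comp_apply funpow_add)
  then have "(gamma_map d ^^ (r * rho d j)) j \<in> {0..int d - 1}"
    using gamma_map_iter_range[OF assms(1) r'] by simp
  then show ?thesis
    using rho_gamma_map_iter[OF assms(1)] by (intro exI[of _ "r * rho d j"]) simp
qed

text \<open>Multiplication by \<open>2\<^sup>\<rho>\<close> fixes \<open>jstar + 1\<close> modulo \<open>d\<close>, so neither the \<open>p\<close> full periods nor the entrance
  time \<open>r\<close>, itself a multiple of \<open>\<rho>\<close>, influence the residue class.\<close>

lemma cong_gamma_map_periodic: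
  assumes "odd d" and jstar: "jstar = (gamma_map d ^^ r) j" and "rho d jstar dvd r"
  shows "[2 ^ (p * rho d jstar + q) * ((gamma_map d ^^ q) jstar + 1) = j + 1] (mod int d)"
proof -
  define \<gamma> where "\<gamma> = (gamma_map d ^^ q) jstar"
  have \<rho>: "rho d \<gamma> = rho d jstar"
    by (simp add: \<gamma>_def rho_gamma_map_iter[OF assms(1)])
  have "[2 ^ q * (2 ^ (p * rho d jstar) * (\<gamma> + 1)) = 2 ^ q * (\<gamma> + 1)] (mod int d)"
    by (intro cong_scalar_left cong_two_power_rho assms(1)) (simp add: \<rho>)
  also have "[2 ^ q * (\<gamma> + 1) = jstar + 1] (mod int d)"
    unfolding \<gamma>_def by (rule cong_gamma_map_iter[OF assms(1)])
  also have "[jstar + 1 = 2 ^ r * (jstar + 1)] (mod int d)"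
    by (rule cong_sym[OF cong_two_power_rho[OF assms(1,3)]])
  also have "[2 ^ r * (jstar + 1) = j + 1] (mod int d)"
    unfolding jstar by (rule cong_gamma_map_iter[OF assms(1)])
  finally show ?thesis
    by (simp add: \<gamma>_def power_add mult_ac)
qed

section \<open>Eulerian polynomials and power sums\<close>

text \<open>Comparison of coefficients in the defining identity \<open>G = x exp(\<lambda>(1-x)) G + (1 - x)\<close> of the generating
  function, multiplied by \<open>k!\<close>.\<close>

lemma eulerian_recurrence:
  "eulerian k = [:0, 1:] * (\<Sum>i\<le>k. of_nat (k choose i) * eulerian i * [:1, -1:] ^ (k - i)) +
     (if k = 0 then [:1, -1:] else 0)"
proof -
  define E where "E = fps_exp (1 - rX)"
  define D where "D = 1 - fps_const rX * E"
  have X: "to_fract [:1, -1:] = 1 - rX"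
    unfolding rX_def by (simp flip: to_fract_1 to_fract_diff add: one_pCons)
  have "fps_nth D 0 \<noteq> 0"
    using rX_neq_1 by (simp add: D_def E_def)
  then have "eulerian_gf * D = fps_const (1 - rX)"
    unfolding eulerian_gf_def E_def[symmetric] D_def[symmetric]
    by (simp add: fps_divide_unit mult.assoc inverse_mult_eq_1)
  then have "eulerian_gf = fps_const rX * (eulerian_gf * E) + fps_const (1 - rX)"
    by (simp add: D_def algebra_simps)
  then have "fps_nth eulerian_gf k = rX * fps_nth (eulerian_gf * E) k + fps_nth (fps_const (1 - rX)) k"
    by (metis fps_add_nth fps_mult_left_const_nth)
  also have "fps_nth (eulerian_gf * E) k =
      (\<Sum>i\<le>k. to_fract (eulerian i) / of_nat (fact i) * ((1 - rX) ^ (k - i) / of_nat (fact (k - i))))"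
    by (simp add: fps_mult_nth E_def eulerian atLeast0AtMost)
  finally have "of_nat (fact k) * fps_nth eulerian_gf k =
      of_nat (fact k) * (rX * (\<Sum>i\<le>k. to_fract (eulerian i) / of_nat (fact i) *
         ((1 - rX) ^ (k - i) / of_nat (fact (k - i)))) + fps_nth (fps_const (1 - rX)) k)"
    by (simp only:)
  moreover have "of_nat (fact k) * fps_nth eulerian_gf k = to_fract (eulerian k)"
    using of_nat_ratfun_neq_0[of "fact k"] by (simp flip: eulerian)
  moreover have "of_nat (fact k) * fps_nth (fps_const (1 - rX)) k =
      to_fract (if k = 0 then [:1, -1:] else 0)"
    by (simp add: X)
  moreover have "of_nat (fact k) * (rX * (\<Sum>i\<le>k. to_fract (eulerian i) / of_nat (fact i) *
         ((1 - rX) ^ (k - i) / of_nat (fact (k - i))))) =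
      rX * (\<Sum>i\<le>k. of_nat (k choose i) * to_fract (eulerian i) * (1 - rX) ^ (k - i))"
    unfolding sum_distrib_left
  proof (intro sum.cong refl)
    fix i assume "i \<in> {..k}"
    then have "fact i * fact (k - i) * (k choose i) = fact k"
      by (simp add: binomial_fact_lemma)
    then have "of_nat (fact k) = (of_nat (fact i) * of_nat (fact (k - i)) * of_nat (k choose i) :: ratfun)"
      by (metis of_nat_mult)
    then show "of_nat (fact k) * (rX * (to_fract (eulerian i) / of_nat (fact i) *
         ((1 - rX) ^ (k - i) / of_nat (fact (k - i))))) =
        rX * (of_nat (k choose i) * to_fract (eulerian i) * (1 - rX) ^ (k - i))"
      using of_nat_ratfun_neq_0[of "fact i"] of_nat_ratfun_neq_0[of "fact (k - i)"]
      by (simp only:) (simp add: field_simps)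
  qed
  ultimately have "to_fract (eulerian k) =
      rX * (\<Sum>i\<le>k. of_nat (k choose i) * to_fract (eulerian i) * (1 - rX) ^ (k - i)) +
      to_fract (if k = 0 then [:1, -1:] else 0)"
    by (simp only: distrib_left)
  also have "\<dots> = to_fract ([:0, 1:] * (\<Sum>i\<le>k. of_nat (k choose i) * eulerian i * [:1, -1:] ^ (k - i)) +
     (if k = 0 then [:1, -1:] else 0))"
    by (simp only: to_fract_add to_fract_mult to_fract_sum to_fract_power to_fract_of_nat X rX_def)
  finally show ?thesis by (simp only: to_fract_eq_iff)
qed

definition power_sum_series :: "nat \<Rightarrow> complex fps" where
  "power_sum_series k = Abs_fps (\<lambda>t. of_nat t ^ k)"

text \<open>Shift by one and expand \<open>(t + 1)\<^sup>k\<close> by the binomial theorem. The convention \<open>0\<^sup>0 = 1\<close> produces the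
  constant term for \<open>k = 0\<close>.\<close>

lemma power_sum_series_recurrence:
  "power_sum_series k = fps_X * (\<Sum>i\<le>k. of_nat (k choose i) * power_sum_series i) +
     (if k = 0 then 1 else 0)"
proof (rule fps_ext)
  fix t
  show "fps_nth (power_sum_series k) t =
    fps_nth (fps_X * (\<Sum>i\<le>k. of_nat (k choose i) * power_sum_series i) + (if k = 0 then 1 else 0)) t"
  proof (cases t)
    case (Suc u)
    have "of_nat t ^ k = (of_nat u + 1 :: complex) ^ k" by (simp add: Suc add.commute)
    also have "\<dots> = (\<Sum>i\<le>k. of_nat (k choose i) * of_nat u ^ i)"
      by (simp add: binomial_ring)
    finally show ?thesis
      by (simp add: Suc power_sum_series_def fps_sum_nth fps_of_nat[symmetric])
  qed (simp add: power_sum_series_def power_0_left)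
qed

text \<open>Both sides satisfy the recurrence of the Eulerian polynomials, which determines its solution because
  \<open>1 - x\<close> is not zero.\<close>

lemma fps_of_poly_eulerian:
  "fps_of_poly (eulerian k) = power_sum_series k * (1 - fps_X) ^ Suc k"
proof (induction k rule: less_induct)
  case (less k)
  define T where "T i = power_sum_series i * (1 - fps_X) ^ Suc i" for i
  define B where "B = (if k = 0 then 1 - fps_X else 0 :: complex fps)"
  have X: "fps_of_poly [:0, 1:] = (fps_X :: complex fps)"
    and X1: "fps_of_poly [:1, -1:] = (1 - fps_X :: complex fps)"
    and of_nat: "fps_of_poly (of_nat i :: complex poly) = of_nat i" for i
    by (rule fps_ext, simp add: coeff_pCons split: nat.splits)+
      (induction i, simp_all add: fps_of_poly_add)
  have B: "fps_of_poly (if k = 0 then [:1, -1:] else 0) = B"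
    using X1 by (simp add: B_def)
  have e: "fps_of_poly (eulerian k) = fps_X * (\<Sum>i\<le>k. of_nat (k choose i) *
      fps_of_poly (eulerian i) * (1 - fps_X) ^ (k - i)) + B"
    by (subst eulerian_recurrence)
      (simp only: fps_of_poly_add fps_of_poly_mult fps_of_poly_sum fps_of_poly_power X X1 of_nat B)
  have "T k = (fps_X * (\<Sum>i\<le>k. of_nat (k choose i) * power_sum_series i) +
     (if k = 0 then 1 else 0)) * (1 - fps_X) ^ Suc k"
    unfolding T_def by (subst power_sum_series_recurrence) (rule refl)
  also have "\<dots> = fps_X * (\<Sum>i\<le>k. of_nat (k choose i) * power_sum_series i * (1 - fps_X) ^ Suc k) + B"
    by (simp add: distrib_right sum_distrib_right mult.assoc B_def)
  also have "(\<Sum>i\<le>k. of_nat (k choose i) * power_sum_series i * (1 - fps_X) ^ Suc k) =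
      (\<Sum>i\<le>k. of_nat (k choose i) * T i * (1 - fps_X) ^ (k - i))"
  proof (intro sum.cong refl)
    fix i assume "i \<in> {..k}"
    then have "(1 - fps_X :: complex fps) ^ Suc k = (1 - fps_X) ^ Suc i * (1 - fps_X) ^ (k - i)"
      by (simp flip: power_add)
    then show "of_nat (k choose i) * power_sum_series i * (1 - fps_X) ^ Suc k =
        of_nat (k choose i) * T i * (1 - fps_X) ^ (k - i)"
      by (simp only: T_def mult.assoc)
  qed
  finally have t: "T k = fps_X * (\<Sum>i\<le>k. of_nat (k choose i) * T i * (1 - fps_X) ^ (k - i)) + B" .
  have split: "(\<Sum>i\<le>k. f i) = (\<Sum>i<k. f i) + f k" for f :: "nat \<Rightarrow> complex fps"
    by (simp flip: lessThan_Suc_atMost)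
  have "(\<Sum>i<k. of_nat (k choose i) * fps_of_poly (eulerian i) * (1 - fps_X) ^ (k - i)) =
      (\<Sum>i<k. of_nat (k choose i) * T i * (1 - fps_X) ^ (k - i))"
    using less by (intro sum.cong) (auto simp: T_def)
  then obtain S where
    "T k = fps_X * (S + T k) + B" "fps_of_poly (eulerian k) = fps_X * (S + fps_of_poly (eulerian k)) + B"
    using t e unfolding split by simp
  moreover have "t * (1 - fps_X) = fps_X * S + B" if "t = fps_X * (S + t) + B" for t
  proof -
    have "t - t * fps_X = fps_X * (S + t) + B - t * fps_X"
      by (rule arg_cong[OF that])
    then show ?thesis by (simp add: algebra_simps)
  qed
  ultimately have "(T k - fps_of_poly (eulerian k)) * (1 - fps_X) = 0"
    unfolding left_diff_distrib by simp
  moreover have "(1 - fps_X :: complex fps) \<noteq> 0"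
    by (metis eq_iff_diff_eq_0 fps_X_neq_one)
  ultimately show ?case by (simp add: T_def)
qed

lemma eulerian_0: "eulerian 0 = 1"
proof -
  define X where "X = [:0, 1 :: complex:]"
  have X: "[:1, -1:] = 1 - X" by (simp add: X_def one_pCons)
  have "eulerian 0 = X * eulerian 0 + (1 - X)"
    using eulerian_recurrence[of 0] by (simp only: X X_def[symmetric]) simp
  then have "(1 - X) * (eulerian 0 - 1) = 0"
    by (simp add: algebra_simps)
  moreover have "1 - X \<noteq> 0" by (simp flip: X)
  ultimately show ?thesis by simp
qed

lemma laurent_expansion_eulerian_at_pow:
  assumes "d > 0"
  shows "laurent_expansion (eulerian_at_pow k d) =
    fps_to_fls (fps_compose (power_sum_series k) (fps_X ^ d)) * (1 - fls_X ^ d) ^ Suc k"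
proof -
  have "fps_of_poly (pcompose (eulerian k) (Polynomial.monom 1 d)) =
      fps_compose (fps_of_poly (eulerian k)) (fps_X ^ d)"
    using assms by (subst fps_of_poly_pcompose) (simp_all add: fps_of_poly_monom')
  also have "\<dots> = fps_compose (power_sum_series k) (fps_X ^ d) * (1 - fps_X ^ d) ^ Suc k"
    using assms unfolding fps_of_poly_eulerian
    by (simp add: fps_compose_mult_distrib fps_compose_sub_distrib flip: fps_compose_power)
  finally show ?thesis
    by (simp add: eulerian_at_pow_def fls_of_poly_def fls_times_fps_to_fls fps_to_fls_power)
qed

section \<open>The limit function\<close>

definition limit_function :: "nat \<Rightarrow> nat \<Rightarrow> int \<Rightarrow> ratfun \<Rightarrow> ratfun" where
  "limit_function n d \<gamma> L = L * rX powi \<gamma> / (of_nat (fact (n - 1)) * (rX ^ d - 1) ^ n) *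
     (\<Sum>l = 0..n - 1. (-1) ^ l * of_nat ((n - 1) choose l) *
        of_int (\<gamma> + 1) ^ l * of_nat d ^ (n - l) * (rX ^ d - 1) ^ l * eulerian_at_pow (n - 1 - l) d)"

lemma fps_to_fls_sum: "fps_to_fls (\<Sum>i\<in>I. f i) = (\<Sum>i\<in>I. fps_to_fls (f i))"
  by (induction I rule: infinite_finite_induct) simp_all

lemma fps_to_fls_prod: "fps_to_fls (\<Prod>i\<in>I. f i) = (\<Prod>i\<in>I. fps_to_fls (f i))"
  by (induction I rule: infinite_finite_induct) (simp_all add: fls_times_fps_to_fls)

lemma fls_X_power_neq_1:
  assumes "d > 0"
  shows "fls_X ^ d \<noteq> (1 :: complex fls)"
proof
  assume "fls_X ^ d = (1 :: complex fls)"
  then have "fls_nth (fls_X ^ d) 0 = fls_nth (1 :: complex fls) 0" by simp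
  then show False using assms by (simp add: fls_X_power_nth)
qed

text \<open>The powers of \<open>x\<^sup>d - 1\<close> in the \<open>l\<close>-th summand leave \<open>A\<^bsub>n-1-l\<^esub>(x\<^sup>d) / (1 - x\<^sup>d)\<^sup>n\<^sup>-\<^sup>l\<close> up to sign, which is
  the series of \<open>i\<^bsup>n-1-l\<^esup>\<close> in \<open>x\<^sup>d\<close>; the sum over \<open>l\<close> is a binomial expansion.\<close>

lemma fls_nth_limit_function:
  assumes "n \<ge> 1" "d > 0"
  shows "fls_nth (laurent_expansion (limit_function n d \<gamma> (1 / of_nat P))) k =
    (if \<gamma> \<le> k \<and> int d dvd k - \<gamma>
     then (-1) ^ n * (of_nat d / of_nat (P * fact (n - 1)) * of_int (k + 1) ^ (n - 1)) else 0)"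
proof -
  define c :: complex where "c = (-1) ^ n * (of_nat d / of_nat (P * fact (n - 1)))"
  define D :: "complex fls" where "D = fls_X ^ d - 1"
  define S where "S l = fps_compose (power_sum_series l) (fps_X ^ d)" for l
  define Q where "Q = (\<Sum>l\<le>n - 1. of_nat ((n - 1) choose l) * of_int (\<gamma> + 1) ^ l *
      of_nat d ^ (n - 1 - l) * S (n - 1 - l))"
  have D: "D \<noteq> 0" using fls_X_power_neq_1[OF assms(2)] by (simp add: D_def)
  have fls_const_of_nat: "fls_const (of_nat i) = of_nat i" for i
    by (metis fls_of_nat)
  have summand: "(-1) ^ l * of_nat ((n - 1) choose l) * of_int (\<gamma> + 1) ^ l * of_nat d ^ (n - l) * D ^ l *
       laurent_expansion (eulerian_at_pow (n - 1 - l) d) =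
     (-1) ^ n * of_nat d * D ^ n * fps_to_fls (of_nat ((n - 1) choose l) * of_int (\<gamma> + 1) ^ l *
      of_nat d ^ (n - 1 - l) * S (n - 1 - l))" if l: "l \<le> n - 1" for l
  proof -
    have ex: "n - l = Suc (n - 1 - l)" using l assms(1) by simp
    have n: "l + (n - l) = n" using l assms(1) by simp
    have "laurent_expansion (eulerian_at_pow (n - 1 - l) d) = fps_to_fls (S (n - 1 - l)) * (- D) ^ (n - l)"
      unfolding laurent_expansion_eulerian_at_pow[OF assms(2)] ex by (simp add: D_def S_def)
    also have "(- D) ^ (n - l) = (-1) ^ (n - l) * D ^ (n - l)" by (rule power_minus)
    finally have e: "laurent_expansion (eulerian_at_pow (n - 1 - l) d) =
        fps_to_fls (S (n - 1 - l)) * ((-1) ^ (n - l) * D ^ (n - l))" .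
    have d: "of_nat d ^ (n - l) = (of_nat d * of_nat d ^ (n - 1 - l) :: complex fls)"
      unfolding ex by (rule power_Suc)
    have "(-1 :: complex fls) ^ n = (-1) ^ l * (-1) ^ (n - l)" "D ^ n = D ^ l * D ^ (n - l)"
      by (simp_all only: power_add[symmetric] n)
    then show ?thesis
      unfolding e d
      by (simp add: fls_times_fps_to_fls fps_to_fls_power fps_to_fls_of_nat fps_to_fls_of_int mult_ac)
  qed
  have "laurent_expansion (limit_function n d \<gamma> (1 / of_nat P)) =
     1 / of_nat P * fls_X powi \<gamma> / (of_nat (fact (n - 1)) * D ^ n) *
     ((-1) ^ n * of_nat d * D ^ n * fps_to_fls Q)"
  proof -
    have "(\<Sum>l = 0..n - 1. (-1) ^ l * of_nat ((n - 1) choose l) * of_int (\<gamma> + 1) ^ l * of_nat d ^ (n - l) * D ^ l *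
       laurent_expansion (eulerian_at_pow (n - 1 - l) d)) =
      (-1) ^ n * of_nat d * D ^ n * fps_to_fls Q"
      unfolding Q_def atLeast0AtMost fps_to_fls_sum sum_distrib_left
      by (intro sum.cong refl summand) simp
    then show ?thesis
      by (simp only: limit_function_def D_def laurent_expansion_mult laurent_expansion_divide
          laurent_expansion_sum laurent_expansion_power laurent_expansion_power_int
          laurent_expansion_diff laurent_expansion_uminus laurent_expansion_1
          laurent_expansion_of_nat laurent_expansion_of_int laurent_expansion_rX)
  qed
  also have "\<dots> = fls_const c * (fls_X powi \<gamma> * fps_to_fls Q)"
  proof -
    have c_eq: "fls_const c = (-1) ^ n * (of_nat d / (of_nat P * of_nat (fact (n - 1))))"
      by (simp only: c_def fls_const_mult_const[symmetric] fls_const_divide_const[symmetric]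
          fls_const_power fls_const_uminus fls_const_1 fls_const_of_nat of_nat_mult)
    have cancel: "1 / p * x / (f * y) * (u * v * y * w) = u * (v / (p * f)) * (x * w)"
      if "y \<noteq> 0" for p x f y u v w :: "complex fls"
    proof -
      have "1 / p * x / (f * y) * (u * v * y * w) = (inverse y * y) * (u * (v / (p * f)) * (x * w))"
        by (simp only: divide_inverse inverse_mult_distrib mult_ac mult_1_left)
      then show ?thesis using that by simp
    qed
    show ?thesis unfolding c_eq by (rule cancel) (use D in simp)
  qed
  also have "fls_X powi \<gamma> * fps_to_fls Q = fls_shift (- \<gamma>) (fps_to_fls Q)"
    by (simp add: fls_X_power_int fls_X_intpow_times_conv_shift)
  finally have "fls_nth (laurent_expansion (limit_function n d \<gamma> (1 / of_nat P))) k =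
      c * (if k < \<gamma> then 0 else fps_nth Q (nat (k - \<gamma>)))"
    by simp
  also have "fps_nth Q t = (if d dvd t then of_int (int t + \<gamma> + 1) ^ (n - 1) else 0)" for t
  proof -
    have const: "(of_nat i * of_int x ^ l * of_nat d ^ r :: complex fps) =
        fps_const (of_nat i * of_int x ^ l * of_nat d ^ r)" for i x l r
      by (simp only: fps_const_mult[symmetric] fps_const_power[symmetric] fps_of_nat fps_of_int)
    have "fps_nth Q t = (\<Sum>l\<le>n - 1. of_nat ((n - 1) choose l) * of_int (\<gamma> + 1) ^ l *
      of_nat d ^ (n - 1 - l) * fps_nth (S (n - 1 - l)) t)"
      unfolding Q_def fps_sum_nth const fps_mult_left_const_nth ..
    also have "\<dots> = (if d dvd t then of_int (int t + \<gamma> + 1) ^ (n - 1) else 0)"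
    proof (cases "d dvd t")
      case True
      then obtain u where u: "t = d * u" ..
      have "fps_nth (S i) t = of_nat u ^ i" for i
        using assms(2) by (simp add: S_def fps_nth_compose_X_power power_sum_series_def u)
      then have "(\<Sum>l\<le>n - 1. of_nat ((n - 1) choose l) * of_int (\<gamma> + 1) ^ l *
          of_nat d ^ (n - 1 - l) * fps_nth (S (n - 1 - l)) t) =
        (of_int (\<gamma> + 1) + of_nat t :: complex) ^ (n - 1)"
        unfolding binomial_ring by (intro sum.cong refl) (simp add: u power_mult_distrib)
      also have "of_int (\<gamma> + 1) + of_nat t = (of_int (int t + \<gamma> + 1) :: complex)" by simp
      finally show ?thesis using True by simp
    qed (simp add: S_def fps_nth_compose_X_power)
    finally show ?thesis .
  qed
  finally have nth: "fls_nth (laurent_expansion (limit_function n d \<gamma> (1 / of_nat P))) k = c *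
      (if k < \<gamma> then 0 else if d dvd nat (k - \<gamma>)
       then of_int (int (nat (k - \<gamma>)) + \<gamma> + 1) ^ (n - 1) else 0)" .
  show ?thesis
  proof (cases "\<gamma> \<le> k")
    case True
    then have int: "int (nat (k - \<gamma>)) = k - \<gamma>" by simp
    have "d dvd nat (k - \<gamma>) \<longleftrightarrow> int d dvd int (nat (k - \<gamma>))"
      by (rule int_dvd_int_iff[symmetric])
    then have dvd: "d dvd nat (k - \<gamma>) \<longleftrightarrow> int d dvd k - \<gamma>"
      unfolding int .
    show ?thesis
      using True unfolding nth c_def dvd int by (simp add: mult.assoc)
  next
    case False
    then show ?thesis unfolding nth by simp
  qed
qed

section \<open>Convergence of the iterates\<close>

lemma fls_nth_Rjn:
  assumes "\<And>i. i \<in> {1..n} \<Longrightarrow> m i > 0"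
  shows "fls_nth (laurent_expansion (Rjn n m j)) k =
    (if k < j then 0 else (-1) ^ n * fps_nth (coin_series n m) (nat (k - j)))"
proof -
  have "inverse (\<Prod>i\<in>{1..n}. fls_X ^ m i - 1 :: complex fls) =
      (\<Prod>i\<in>{1..n}. (- 1) * fps_to_fls (inverse (1 - fps_X ^ m i)))"
    unfolding prod_inversef[symmetric] o_def
  proof (intro prod.cong refl)
    fix i assume i: "i \<in> {1..n}"
    have "fls_X ^ m i - 1 = - fps_to_fls (1 - fps_X ^ m i :: complex fps)"
      by (simp add: fps_to_fls_power)
    then have "inverse (fls_X ^ m i - 1) = - inverse (fps_to_fls (1 - fps_X ^ m i :: complex fps))"
      by (simp only: inverse_minus_eq)
    also have "inverse (fps_to_fls (1 - fps_X ^ m i :: complex fps)) =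
        fps_to_fls (inverse (1 - fps_X ^ m i))"
      using assms[OF i] by (intro fls_inverse_fps_to_fls) (simp add: subdegree_eq_0)
    finally show "inverse (fls_X ^ m i - 1) = - 1 * fps_to_fls (inverse (1 - fps_X ^ m i :: complex fps))"
      by simp
  qed
  also have "\<dots> = (-1) ^ n * fps_to_fls (coin_series n m)"
    unfolding prod.distrib coin_series_def
    by (simp add: fps_to_fls_prod)
  finally have "laurent_expansion (Rjn n m j) =
      fls_X powi j * ((-1) ^ n * fps_to_fls (coin_series n m))"
    by (simp add: Rjn_def divide_inverse)
  also have "\<dots> = fls_const ((-1) ^ n) * fls_shift (- j) (fps_to_fls (coin_series n m))"
    unfolding fls_const_power fls_const_uminus fls_const_1 fls_X_power_int
    by (subst mult.left_commute) (simp only: fls_X_intpow_times_conv_shift)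
  finally show ?thesis by simp
qed

text \<open>The denominator \<open>V = x\<^bsup>max(0,-j)\<^esup> \<Prod> (x\<^bsup>m i\<^esup> - 1)\<close> divides \<open>V(x\<^sup>2)\<close> and has no zero in common with the
  numerator of \<open>R\<^sub>j\<^sub>,\<^sub>n\<close>, so it does not vanish at the regular points.\<close>

lemma bisect_iter_Rjn_fractions:
  assumes "\<And>i. i \<in> {1..n} \<Longrightarrow> m i > 0"
  obtains V M where "V \<noteq> 0" "\<And>x. regular_at (Rjn n m j) x \<Longrightarrow> poly V x \<noteq> 0"
    "\<And>p. \<exists>T. (bisect ^^ p) (Rjn n m j) = Fract T V \<and> degree T \<le> M"
proof -
  define X where "X = [:0, 1 :: complex:]"
  define V where "V = X ^ nat (- j) * (\<Prod>i\<in>{1..n}. X ^ m i - 1)"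
  define W where "W = X ^ nat (- j) * (\<Prod>i\<in>{1..n}. X ^ m i + 1)"
  define H where "H = X ^ nat j"
  have eval: "poly X x = x" for x by (simp add: X_def)
  have nz: "X ^ m i - 1 \<noteq> 0" if "i \<in> {1..n}" for i
  proof -
    have "poly (X ^ m i - 1) 0 \<noteq> 0" using assms[OF that] by (simp add: eval zero_power)
    then show ?thesis by (rule contrapos_nn) (simp only: poly_0)
  qed
  have "X \<noteq> 0" by (simp add: X_def)
  moreover have "(\<Prod>i\<in>{1..n}. X ^ m i - 1) \<noteq> 0"
    unfolding prod_zero_iff[OF finite_atLeastAtMost] using nz by blast
  ultimately have V: "V \<noteq> 0" unfolding V_def by (intro no_zero_divisors power_not_zero)
  have R: "Rjn n m j = Fract H V"
  proof -
    have rX: "rX ^ i = to_fract (X ^ i)" for i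
      unfolding to_fract_power by (simp only: rX_def X_def)
    have "rX powi j = rX ^ nat j / rX ^ nat (- j)"
      by (cases "j \<ge> 0") (simp_all add: power_int_def divide_inverse power_inverse)
    moreover have "(\<Prod>i\<in>{1..n}. to_fract (X ^ m i) - 1) = to_fract (\<Prod>i\<in>{1..n}. X ^ m i - 1)"
      by (induction n) simp_all
    ultimately show ?thesis
      by (simp only: Rjn_def Fract_conv_to_fract H_def V_def rX to_fract_mult divide_divide_eq_left)
  qed
  have W: "V * W = pcompose V [:0, 0, 1:]"
  proof -
    have X2: "pcompose X [:0, 0, 1:] = X * X" by (simp add: X_def pcompose_pCons)
    have pow: "pcompose (X ^ i) [:0, 0, 1:] = X ^ i * X ^ i" for i
      by (induction i) (simp_all add: pcompose_mult pcompose_1 X2 mult_ac)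
    have factor: "pcompose (X ^ i - 1) [:0, 0, 1:] = (X ^ i - 1) * (X ^ i + 1)" for i
      unfolding pcompose_diff pcompose_1 pow square_diff_one_factored by (rule mult.commute)
    have "pcompose (\<Prod>i\<in>{1..n}. X ^ m i - 1) [:0, 0, 1:] =
        (\<Prod>i\<in>{1..n}. (X ^ m i - 1) * (X ^ m i + 1))"
      by (simp only: pcompose_prod factor)
    then show ?thesis
      unfolding V_def W_def pcompose_mult pow prod.distrib by (simp only: mult_ac)
  qed
  have regular: "poly V x \<noteq> 0" if "regular_at (Rjn n m j) x" for x
  proof
    assume zero: "poly V x = 0"
    have "poly H x \<noteq> 0"
    proof (cases "j > 0")
      case True
      \<comment> \<open>Only a negative \<open>j\<close> puts a factor \<open>x\<close> into \<open>V\<close>.\<close>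
      with zero obtain i where "i \<in> {1..n}" "x ^ m i = 1"
        by (auto simp: V_def poly_prod eval)
      then have "x \<noteq> 0" using assms[of i] by (auto simp: power_0_left)
      then show ?thesis by (simp add: H_def eval)
    qed (simp add: H_def)
    then show False using not_regular_at_Fract[OF zero _ V, of H] that by (simp add: R)
  qed
  have "\<exists>T. (bisect ^^ p) (Rjn n m j) = Fract T V \<and> degree T \<le> max (degree W) (degree H)" for p
    unfolding R by (rule bisect_iter_Fract[OF V W]) auto
  with V regular show ?thesis by (rule that)
qed

text \<open>For \<open>k \<ge> 0\<close> the index \<open>2\<^sup>e (k + 1) - 1\<close> tends to infinity and the asymptotics apply; for \<open>k < -1\<close> it tends
  to minus infinity, where the coefficients vanish. For \<open>k = -1\<close> the index is constantly \<open>-1\<close>: the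
  quotient tends to \<open>0\<close> if \<open>n \<ge> 2\<close>, while for \<open>n = 1\<close> it is constant and the last hypothesis says that
  the limit function has the same coefficient.\<close>

lemma coefficients_converge:
  fixes m :: "nat \<Rightarrow> nat" and e :: "nat \<Rightarrow> nat"
  assumes n: "n \<ge> 1" and odd: "\<And>i. i \<in> {1..n} \<Longrightarrow> odd (m i)"
  defines "d \<equiv> Gcd (m ` {1..n})"
  assumes e: "filterlim e at_top sequentially"
    and \<gamma>: "\<gamma> \<in> {- 1..int d - 1}"
    and cong: "\<And>p. [2 ^ e p * (\<gamma> + 1) = j + 1] (mod int d)"
    and n1: "n = 1 \<Longrightarrow> \<gamma> = - 1 \<longleftrightarrow> j < 0 \<and> int d dvd j + 1"
  shows "(\<lambda>p. fls_nth (laurent_expansion (Rjn n m j)) (2 ^ e p * (k + 1) - 1) / 2 ^ ((n - 1) * e p))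
    \<longlonglongrightarrow> fls_nth (laurent_expansion (limit_function n d \<gamma> (1 / of_nat (\<Prod>i\<in>{1..n}. m i)))) k"
proof -
  have pos: "m i > 0" if "i \<in> {1..n}" for i using odd[OF that] by (auto elim: oddE)
  have "m 1 \<in> m ` {1..n}" "odd (m 1)" using n odd by auto
  then have "odd d" unfolding d_def by (metis Gcd_dvd dvd_trans)
  then have d: "d > 0" by (auto elim: oddE)
  have N: "filterlim (\<lambda>p. 2 ^ e p :: nat) at_top sequentially"
    by (rule filterlim_compose[OF _ e]) (rule filterlim_at_top_mono[OF filterlim_ident], auto intro: less_imp_le)
  define a where "a = fls_nth (laurent_expansion (Rjn n m j))"
  have a: "a i = (if i < j then 0 else (-1) ^ n * fps_nth (coin_series n m) (nat (i - j)))" for i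
    using fls_nth_Rjn[of n m j i] pos by (simp add: a_def)
  have big: "eventually (\<lambda>p. int (2 ^ e p) > B) sequentially" for B
  proof -
    have "eventually (\<lambda>p. Suc (nat B) \<le> 2 ^ e p) sequentially"
      using N unfolding filterlim_at_top by blast
    then show ?thesis
    proof eventually_elim
      case (elim p)
      then have "int (Suc (nat B)) \<le> int (2 ^ e p)" by (simp only: of_nat_le_iff)
      then show ?case by linarith
    qed
  qed
  consider "k < - 1" | "k = - 1" | "k \<ge> 0" by linarith
  then show ?thesis
    unfolding a_def[symmetric] fls_nth_limit_function[OF n d]
  proof cases
    case 1
    have "eventually (\<lambda>p. a (2 ^ e p * (k + 1) - 1) / 2 ^ ((n - 1) * e p) = 0) sequentially"
      using big[of "- j"]
    proof eventually_elim
      case (elim p)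
      have "2 ^ e p * (k + 1) \<le> 2 ^ e p * (- 1)" using 1 by (intro mult_left_mono) auto
      then show ?case using elim by (simp add: a)
    qed
    moreover have "\<not> \<gamma> \<le> k" using 1 \<gamma> by auto
    ultimately show "(\<lambda>p. a (2 ^ e p * (k + 1) - 1) / 2 ^ ((n - 1) * e p)) \<longlonglongrightarrow>
       (if \<gamma> \<le> k \<and> int d dvd k - \<gamma> then (-1) ^ n * (of_nat d / of_nat ((\<Prod>i\<in>{1..n}. m i) * fact (n - 1)) *
         of_int (k + 1) ^ (n - 1)) else 0)"
      by (simp add: tendsto_eventually)
  next
    case 2
    show "(\<lambda>p. a (2 ^ e p * (k + 1) - 1) / 2 ^ ((n - 1) * e p)) \<longlonglongrightarrow>
       (if \<gamma> \<le> k \<and> int d dvd k - \<gamma> then (-1) ^ n * (of_nat d / of_nat ((\<Prod>i\<in>{1..n}. m i) * fact (n - 1)) *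
         of_int (k + 1) ^ (n - 1)) else 0)"
    proof (cases "n = 1")
      case True
      have dm: "d = m 1" by (simp add: d_def True)
      have "int d dvd j + 1 \<longleftrightarrow> d dvd nat (- 1 - j)" if "j < 0"
      proof -
        have "int d dvd j + 1 \<longleftrightarrow> int d dvd - (j + 1)" by (simp only: dvd_minus_iff)
        also have "- (j + 1) = int (nat (- 1 - j))" using that by simp
        finally show ?thesis by (simp only: int_dvd_int_iff)
      qed
      then have "a (- 1) = (if \<gamma> = - 1 then - 1 else 0)"
        using n1[OF True] coin_series_1_nth[of m] d by (auto simp: a True dm)
      then show ?thesis using 2 True \<gamma> d by (auto simp: dm)
    next
      case False
      have "(\<lambda>p. a (- 1) / (2 ^ e p) ^ (n - 1)) \<longlonglongrightarrow> 0"
      proof -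
        have "filterlim (\<lambda>p. real (2 ^ e p)) at_top sequentially"
          by (rule filterlim_compose[OF filterlim_real_sequentially N])
        then have "filterlim (\<lambda>p. norm ((2 ^ e p :: complex) ^ (n - 1))) at_top sequentially"
          using False n by (auto simp: norm_power intro!: filterlim_pow_at_top)
        then have "filterlim (\<lambda>p. (2 ^ e p :: complex) ^ (n - 1)) at_infinity sequentially"
          by (rule filterlim_norm_at_top_imp_at_infinity)
        then show ?thesis by (rule tendsto_divide_0[OF tendsto_const])
      qed
      moreover have "(2 ^ e p) ^ (n - 1) = (2 :: complex) ^ ((n - 1) * e p)" for p
        by (simp add: power_mult[symmetric] mult.commute)
      ultimately show ?thesis using 2 False n by (simp add: power_0_left)
    qed
  next
    case 3
    define s where "s p = nat (2 ^ e p * (k + 1) - 1 - j)" for p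
    have s: "eventually (\<lambda>p. int (s p) = int (2 ^ e p) * (k + 1) - 1 - j) sequentially"
      using big[of "\<bar>1 + j\<bar>"]
    proof eventually_elim
      case (elim p)
      have "int (2 ^ e p) * 1 \<le> int (2 ^ e p) * (k + 1)" using 3 by (intro mult_left_mono) auto
      then have "0 \<le> int (2 ^ e p) * (k + 1) - 1 - j" using elim by linarith
      then show ?case by (simp add: s_def)
    qed
    have "eventually (\<lambda>p. Z \<le> s p) sequentially" for Z
      using s big[of "int Z + \<bar>1 + j\<bar>"]
    proof eventually_elim
      case (elim p)
      have "int (2 ^ e p) * 1 \<le> int (2 ^ e p) * (k + 1)" using 3 by (intro mult_left_mono) auto
      then show ?case using elim by linarith
    qed
    then have "filterlim s at_top sequentially" unfolding filterlim_at_top by blast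
    moreover have "(\<lambda>p. real (s p) / real (2 ^ e p)) \<longlonglongrightarrow> of_int (k + 1)"
    proof (rule Lim_transform_eventually)
      have "(\<lambda>p. 1 / real (2 ^ e p)) \<longlonglongrightarrow> 0"
        by (rule filterlim_compose[OF lim_1_over_n N])
      then have "(\<lambda>p. of_int (k + 1) - of_int (1 + j) * (1 / real (2 ^ e p))) \<longlonglongrightarrow>
          of_int (k + 1) - of_int (1 + j) * 0"
        by (intro tendsto_intros)
      then show "(\<lambda>p. of_int (k + 1) - of_int (1 + j) * (1 / real (2 ^ e p))) \<longlonglongrightarrow> of_int (k + 1)"
        by simp
      show "eventually (\<lambda>p. of_int (k + 1) - of_int (1 + j) * (1 / real (2 ^ e p)) =
          real (s p) / real (2 ^ e p)) sequentially"
        using s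
      proof eventually_elim
        case (elim p)
        then have "real (s p) = real_of_int (int (2 ^ e p) * (k + 1) - 1 - j)"
          by (metis of_int_of_nat_eq)
        then show ?case by (simp add: field_simps)
      qed
    qed
    moreover have "eventually (\<lambda>p. Gcd (m ` {1..n}) dvd s p \<longleftrightarrow> int d dvd k - \<gamma>) sequentially"
      using s
    proof eventually_elim
      case (elim p)
      \<comment> \<open>Modulo \<open>d\<close> the number \<open>s p\<close> is \<open>2\<^sup>e (k - \<gamma>)\<close>, and \<open>2\<close> is invertible.\<close>
      have "int d dvd 2 ^ e p * (\<gamma> + 1) - (j + 1)" using cong[of p] by (simp only: cong_iff_dvd_diff)
      then have "int d dvd int (s p) \<longleftrightarrow> int d dvd int (s p) - (2 ^ e p * (\<gamma> + 1) - (j + 1))"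
        by (metis dvd_diff dvd_add diff_add_cancel)
      also have "int (s p) - (2 ^ e p * (\<gamma> + 1) - (j + 1)) = 2 ^ e p * (k - \<gamma>)"
        by (simp add: elim algebra_simps)
      also have "int d dvd \<dots> \<longleftrightarrow> int d dvd k - \<gamma>"
        using \<open>odd d\<close> by (intro coprime_dvd_mult_right_iff) auto
      finally show ?case by (simp add: d_def)
    qed
    ultimately have "(\<lambda>p. fps_nth (coin_series n m) (s p) / of_nat (2 ^ e p) ^ (n - 1)) \<longlonglongrightarrow>
     (if int d dvd k - \<gamma> then of_nat (Gcd (m ` {1..n})) / of_nat ((\<Prod>k\<in>{1..n}. m k) * fact (n - 1)) *
       of_real (of_int (k + 1) ^ (n - 1)) else 0)"
      using n pos N by (intro coin_series_limit) auto
    then have "(\<lambda>p. (-1) ^ n * (fps_nth (coin_series n m) (s p) / of_nat (2 ^ e p) ^ (n - 1))) \<longlonglongrightarrow>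
     (-1) ^ n * (if int d dvd k - \<gamma> then of_nat d / of_nat ((\<Prod>k\<in>{1..n}. m k) * fact (n - 1)) *
       of_real (of_int (k + 1) ^ (n - 1)) else 0)"
      unfolding d_def by (rule tendsto_mult_left)
    also have "(-1) ^ n * (if int d dvd k - \<gamma> then of_nat d / of_nat ((\<Prod>k\<in>{1..n}. m k) * fact (n - 1)) *
       of_real (of_int (k + 1) ^ (n - 1)) else 0 :: complex) = 
      (if \<gamma> \<le> k \<and> int d dvd k - \<gamma> then (-1) ^ n * (of_nat d / of_nat ((\<Prod>i\<in>{1..n}. m i) * fact (n - 1)) *
         of_int (k + 1) ^ (n - 1)) else 0)"
    proof -
      have "\<gamma> \<le> k" if "int d dvd k - \<gamma>"
      proof (rule ccontr)
        assume "\<not> \<gamma> \<le> k"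
        then have "int d \<le> \<gamma> - k" using that by (metis dvd_diff_commute zdvd_imp_le diff_gt_0_iff_gt not_le)
        then show False using \<gamma> 3 by auto
      qed
      then show ?thesis by auto
    qed
    finally show "(\<lambda>p. a (2 ^ e p * (k + 1) - 1) / 2 ^ ((n - 1) * e p)) \<longlonglongrightarrow>
       (if \<gamma> \<le> k \<and> int d dvd k - \<gamma> then (-1) ^ n * (of_nat d / of_nat ((\<Prod>i\<in>{1..n}. m i) * fact (n - 1)) *
         of_int (k + 1) ^ (n - 1)) else 0)"
    proof (rule Lim_transform_eventually)
      show "eventually (\<lambda>p. (-1) ^ n * (fps_nth (coin_series n m) (s p) / of_nat (2 ^ e p) ^ (n - 1)) =
          a (2 ^ e p * (k + 1) - 1) / 2 ^ ((n - 1) * e p)) sequentially"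
        using s
      proof eventually_elim
        case (elim p)
        then have "\<not> 2 ^ e p * (k + 1) - 1 < j" by simp
        then show ?case by (simp add: a s_def power_mult[symmetric] mult.commute)
      qed
    qed
  qed
qed

text \<open>Both parts of the main result are instances, with \<open>e p = p\<close> and with \<open>e p = p \<rho> + q\<close>.\<close>

theorem bisect_iterates_converge:
  fixes m :: "nat \<Rightarrow> nat" and e :: "nat \<Rightarrow> nat"
  assumes n: "n \<ge> 1" and odd: "\<And>i. i \<in> {1..n} \<Longrightarrow> odd (m i)"
  defines "d \<equiv> Gcd (m ` {1..n})"
  assumes e: "filterlim e at_top sequentially"
    and \<gamma>: "\<gamma> \<in> {- 1..int d - 1}"
    and cong: "\<And>p. [2 ^ e p * (\<gamma> + 1) = j + 1] (mod int d)"
    and n1: "n = 1 \<Longrightarrow> \<gamma> = - 1 \<longleftrightarrow> j < 0 \<and> int d dvd j + 1"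
  shows "converges_on {x. regular_at (Rjn n m j) x}
     (\<lambda>p. (bisect ^^ e p) (Rjn n m j) / 2 ^ ((n - 1) * e p))
     (limit_function n d \<gamma> (1 / of_nat (\<Prod>i\<in>{1..n}. m i)))"
proof -
  have pos: "m i > 0" if "i \<in> {1..n}" for i using odd[OF that] by (auto elim: oddE)
  obtain V M where V: "V \<noteq> 0" "\<And>x. regular_at (Rjn n m j) x \<Longrightarrow> poly V x \<noteq> 0"
    and "\<And>p. \<exists>T. (bisect ^^ p) (Rjn n m j) = Fract T V \<and> degree T \<le> M"
    using bisect_iter_Rjn_fractions[of n m j] pos by blast
  then obtain T where T: "\<And>p. (bisect ^^ p) (Rjn n m j) = Fract (T p) V" "\<And>p. degree (T p) \<le> M"
    by metis
  define c where "c p = [:1 / 2 ^ ((n - 1) * e p) :: complex:]" for p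
  have c: "to_fract (c p) = 1 / 2 ^ ((n - 1) * e p)" for p
  proof -
    have "c p * 2 ^ ((n - 1) * e p) = 1"
      by (simp add: c_def numeral_poly poly_const_pow)
    then have prod: "to_fract (c p) * 2 ^ ((n - 1) * e p) = 1"
      by (metis to_fract_1 to_fract_mult to_fract_power to_fract_of_nat of_nat_numeral)
    have "(2 :: ratfun) ^ ((n - 1) * e p) \<noteq> 0"
      using of_nat_ratfun_neq_0[of 2] by simp
    then show ?thesis using prod by (rule eq_divide_imp)
  qed
  show ?thesis
  proof (rule converges_on_of_coefficients[OF _ _ V(1)])
    show "(bisect ^^ e p) (Rjn n m j) / 2 ^ ((n - 1) * e p) = Fract (c p * T (e p)) V" for p
      unfolding T(1) Fract_conv_to_fract to_fract_mult c by simp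
    show "degree (c p * T (e p)) \<le> M" for p
      using T(2)[of "e p"] by (simp add: c_def degree_smult_le[THEN order_trans])
    show "poly V x \<noteq> 0" if "x \<in> {x. regular_at (Rjn n m j) x}" for x
      using V(2) that by simp
    fix k
    have "laurent_expansion ((bisect ^^ e p) (Rjn n m j) / 2 ^ ((n - 1) * e p)) =
        fls_const (1 / 2 ^ ((n - 1) * e p)) * laurent_expansion ((bisect ^^ e p) (Rjn n m j))" for p
    proof -
      have "(bisect ^^ e p) (Rjn n m j) / 2 ^ ((n - 1) * e p) = to_fract (c p) * (bisect ^^ e p) (Rjn n m j)"
        by (simp add: c)
      then show ?thesis
        by (simp only: laurent_expansion_mult laurent_expansion_to_fract) (simp add: c_def)
    qed
    then have eq: "fls_nth (laurent_expansion ((bisect ^^ e p) (Rjn n m j) / 2 ^ ((n - 1) * e p))) k =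
        fls_nth (laurent_expansion (Rjn n m j)) (2 ^ e p * (k + 1) - 1) / 2 ^ ((n - 1) * e p)" for p
      by (simp add: fls_nth_bisect_iter)
    show "(\<lambda>p. fls_nth (laurent_expansion ((bisect ^^ e p) (Rjn n m j) / 2 ^ ((n - 1) * e p))) k)
      \<longlonglongrightarrow> fls_nth (laurent_expansion (limit_function n d \<gamma> (1 / of_nat (\<Prod>i\<in>{1..n}. m i)))) k"
      unfolding eq d_def
      by (rule coefficients_converge[OF n odd e \<gamma>[unfolded d_def] cong[unfolded d_def] n1[unfolded d_def]])
  qed
qed

text \<open>At \<open>\<gamma> = -1\<close> only the summand \<open>l = 0\<close> survives.\<close>

lemma limit_function_minus_one:
  assumes "n \<ge> 1"
  shows "limit_function n d (- 1) L = L * of_nat d ^ n * eulerian_at_pow (n - 1) d /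
     (rX * of_nat (fact (n - 1)) * (rX ^ d - 1) ^ n)"
proof -
  have "(\<Sum>l = 0..n - 1. (-1) ^ l * of_nat ((n - 1) choose l) * of_int (- 1 + 1) ^ l *
      of_nat d ^ (n - l) * (rX ^ d - 1) ^ l * eulerian_at_pow (n - 1 - l) d) =
    (\<Sum>l = 0..n - 1. if l = 0 then of_nat d ^ n * eulerian_at_pow (n - 1) d else 0)"
    by (intro sum.cong refl) (auto simp: power_0_left)
  also have "\<dots> = of_nat d ^ n * eulerian_at_pow (n - 1) d"
    by simp
  finally show ?thesis
    unfolding limit_function_def by (simp add: power_int_minus divide_inverse mult_ac)
qed

lemma limit_function_single:
  assumes "d > 0"
  shows "limit_function 1 d (int d - 1) (1 / of_nat d) = rX ^ (d - 1) / (rX ^ d - 1)"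
proof -
  have "rX powi (int d - 1) = rX ^ (d - 1)"
    using assms by (metis of_nat_1 of_nat_diff power_int_of_nat Suc_leI One_nat_def)
  then show ?thesis
    using of_nat_ratfun_neq_0[of d] assms
    by (simp add: limit_function_def eulerian_at_pow_def eulerian_0 pcompose_1)
qed

theorem theorem3p8:
  fixes n d :: nat and m :: "nat \<Rightarrow> nat" and j :: int and L R :: ratfun
  assumes "n \<ge> 1"
    and "\<forall>k\<in>{1..n}. odd (m k)"
    and "d = Gcd (m ` {1..n})"
    and "L = 1 / of_nat (\<Prod>k\<in>{1..n}. m k)"
    and "R = Rjn n m j"
  shows
    "(j \<in> A_set d \<longrightarrow>
        (n \<ge> 2 \<or> j \<in> E_set d (-1) \<longrightarrow>
           converges_on {x. regular_at R x}
             (\<lambda>p. (bisect ^^ p) R / 2 ^ ((n - 1) * p))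
             (L * of_nat d ^ n * eulerian_at_pow (n - 1) d /
                (rX * of_nat (fact (n - 1)) * (rX ^ d - 1) ^ n))) \<and>
        (n = 1 \<and> j \<in> E_set d (int d - 1) \<longrightarrow>
           converges_on {x. regular_at R x}
             (\<lambda>p. (bisect ^^ p) R / 2 ^ ((n - 1) * p))
             (rX ^ (d - 1) / (rX ^ d - 1)))) \<and>
     (j \<notin> A_set d \<longrightarrow>
        (\<exists>r. (gamma_map d ^^ r) j \<in> {0..int d - 1} \<and> rho d ((gamma_map d ^^ r) j) dvd r) \<and>
        (\<forall>r jstar. jstar = (gamma_map d ^^ r) j \<and> jstar \<in> {0..int d - 1} \<and>
             rho d jstar dvd r \<longrightarrow>
           (\<forall>q<rho d jstar. \<forall>\<gamma>. \<gamma> = (gamma_map d ^^ q) jstar \<longrightarrow>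
              converges_on {x. regular_at R x}
                (\<lambda>p. (bisect ^^ (p * rho d jstar + q)) R /
                       2 ^ ((n - 1) * (p * rho d jstar + q)))
                (L * rX powi \<gamma> / (of_nat (fact (n - 1)) * (rX ^ d - 1) ^ n) *
                   (\<Sum>l = 0..n - 1. (-1) ^ l * of_nat ((n - 1) choose l) *
                      of_int (\<gamma> + 1) ^ l * of_nat d ^ (n - l) * (rX ^ d - 1) ^ l *
                      eulerian_at_pow (n - 1 - l) d)))))"
proof -
  have "m 1 \<in> m ` {1..n}" "odd (m 1)" using assms(1,2) by auto
  then have "odd d" unfolding assms(3) by (metis Gcd_dvd dvd_trans)
  then have d: "d > 0" by (auto elim: oddE)
  have converge: "converges_on {x. regular_at R x} (\<lambda>p. (bisect ^^ e p) R / 2 ^ ((n - 1) * e p))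
      (limit_function n d \<gamma> L)"
    if "filterlim e at_top sequentially" "\<gamma> \<in> {- 1..int d - 1}"
      "\<And>p. [2 ^ e p * (\<gamma> + 1) = j + 1] (mod int d)"
      "n = 1 \<Longrightarrow> \<gamma> = - 1 \<longleftrightarrow> j < 0 \<and> int d dvd j + 1" for e \<gamma>
    using bisect_iterates_converge[of n m e \<gamma> j] that assms by blast
  show ?thesis
  proof (intro conjI impI allI; (elim conjE)?)
    assume "j \<in> A_set d" and *: "n \<ge> 2 \<or> j \<in> E_set d (- 1)"
    then have dvd: "int d dvd j + 1" using A_set_imp_dvd[OF \<open>odd d\<close>] by blast
    show "converges_on {x. regular_at R x} (\<lambda>p. (bisect ^^ p) R / 2 ^ ((n - 1) * p))
             (L * of_nat d ^ n * eulerian_at_pow (n - 1) d /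
                (rX * of_nat (fact (n - 1)) * (rX ^ d - 1) ^ n))"
      unfolding limit_function_minus_one[OF assms(1), symmetric]
    proof (rule converge[OF filterlim_ident])
      show "[2 ^ p * (- 1 + 1) = j + 1] (mod int d)" for p
        using dvd by (simp add: cong_0_iff cong_sym_eq[of 0])
      show "n = 1 \<Longrightarrow> (- 1 :: int) = - 1 \<longleftrightarrow> j < 0 \<and> int d dvd j + 1"
        using * dvd E_set_minus_one_imp_negative[OF \<open>odd d\<close>] by auto
    qed auto
  next
    assume "j \<in> A_set d" and n: "n = 1" and top: "j \<in> E_set d (int d - 1)"
    then have dvd: "int d dvd j + 1" using A_set_imp_dvd[OF \<open>odd d\<close>] by blast
    have "converges_on {x. regular_at R x} (\<lambda>p. (bisect ^^ p) R / 2 ^ ((n - 1) * p))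
             (limit_function n d (int d - 1) L)"
    proof (rule converge[OF filterlim_ident])
      have "[2 ^ p * int d = 0] (mod int d)" for p by (simp add: cong_0_iff)
      moreover have "[0 = j + 1] (mod int d)" using dvd by (simp add: cong_0_iff cong_sym_eq[of 0])
      ultimately show "[2 ^ p * (int d - 1 + 1) = j + 1] (mod int d)" for p
        by (simp only: diff_add_cancel) (blast intro: cong_trans)
      show "int d - 1 = - 1 \<longleftrightarrow> j < 0 \<and> int d dvd j + 1"
        using d E_set_top_imp_nonnegative[OF \<open>odd d\<close> top] by auto
    qed (use d in auto)
    moreover have "L = 1 / of_nat d" by (simp add: assms(3,4) n)
    ultimately show "converges_on {x. regular_at R x} (\<lambda>p. (bisect ^^ p) R / 2 ^ ((n - 1) * p))
             (rX ^ (d - 1) / (rX ^ d - 1))"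
      using limit_function_single[OF d] by (simp only: n)
  next
    assume "j \<notin> A_set d"
    then show "\<exists>r. (gamma_map d ^^ r) j \<in> {0..int d - 1} \<and> rho d ((gamma_map d ^^ r) j) dvd r"
      by (rule gamma_map_iter_enters_in_phase[OF \<open>odd d\<close>])
  next
    fix r jstar q \<gamma>
    assume j: "j \<notin> A_set d" and jstar: "jstar = (gamma_map d ^^ r) j" "jstar \<in> {0..int d - 1}"
      "rho d jstar dvd r" and \<gamma>: "\<gamma> = (gamma_map d ^^ q) jstar"
    have \<gamma>_range: "\<gamma> \<in> {0..int d - 1}"
      unfolding \<gamma> by (rule gamma_map_iter_range[OF \<open>odd d\<close> jstar(2)])
    show "converges_on {x. regular_at R x}
       (\<lambda>p. (bisect ^^ (p * rho d jstar + q)) R / 2 ^ ((n - 1) * (p * rho d jstar + q)))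
       (L * rX powi \<gamma> / (of_nat (fact (n - 1)) * (rX ^ d - 1) ^ n) *
          (\<Sum>l = 0..n - 1. (-1) ^ l * of_nat ((n - 1) choose l) *
             of_int (\<gamma> + 1) ^ l * of_nat d ^ (n - l) * (rX ^ d - 1) ^ l *
             eulerian_at_pow (n - 1 - l) d))"
      unfolding limit_function_def[symmetric]
    proof (rule converge)
      have "p \<le> p * rho d jstar + q" for p
        using rho_pos[OF \<open>odd d\<close>, of jstar] by (simp add: trans_le_add1)
      then show "filterlim (\<lambda>p. p * rho d jstar + q) at_top sequentially"
        by (intro filterlim_at_top_mono[OF filterlim_ident]) simp
      show "[2 ^ (p * rho d jstar + q) * (\<gamma> + 1) = j + 1] (mod int d)" for p
        unfolding \<gamma> by (rule cong_gamma_map_periodic[OF \<open>odd d\<close> jstar(1,3)])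
      show "\<gamma> = - 1 \<longleftrightarrow> j < 0 \<and> int d dvd j + 1"
        using \<gamma>_range j dvd_imp_A_set[OF \<open>odd d\<close>] by auto
    qed (use \<gamma>_range in auto)
  qed
qed

end
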